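(* Let $\mathcal{L}$ be an operator on $\mathbb{R}^n$ satisfying the standing assumptions listed in the context. Let $1\le p<\infty$ and let $u\in L^p(\mathbb{R}^n,\mathbb{R})$ be a smooth solution to $\mathcal{L}u=0$ in $\mathbb{R}^n$. Then $u\equiv 0$.
   Context: Standing assumptions. $\mathcal{L}:=\mathrm{div}(A\nabla)+\langle b,\nabla\rangle$ is a linear second order partial differential operator on $\mathbb{R}^n$, where $A=(a_{ij})_{i,j=1,\dots,n}$ is a symmetric $n\times n$ matrix with entries $a_{ij}\in C^\infty(\mathbb{R}^n,\mathbb{R})$, $b=(b_1,\dots,b_n)$ has components $b_j\in C^\infty(\mathbb{R}^n,\mathbb{R})$, and $\mathrm{div}$, $\nabla$, $\langle\cdot,\cdot\rangle$ are the Euclidean divergence, gradient and inner product. It is assumed that $\langle A(x)\xi,\xi\rangle\ge 0$ for all $x,\xi\in\mathbb{R}^n$ and $\mathrm{trace}\,A(0)>0$. Moreover: (1) $\mathcal{L}$ is hypoelliptic: if $w$ is a distribution on an open set $\Omega\subseteq\mathbb{R}^n$ and $\mathcal{L}w$ is smooth in $\Omega$, then $w$ is smooth in $\Omega$. (2) There is a Lie group $\mathbb{G}=(\mathbb{R}^n,\circ)$ such that $\mathcal{L}$ is left translation invariant on $\mathbb{G}$, i.e. $\mathcal{L}(w(\alpha\circ\cdot))(x)=(\mathcal{L}w)(\alpha\circ x)$ for all $\alpha,x\in\mathbb{R}^n$ and all $w\in C^\infty(\mathbb{R}^n,\mathbb{R})$. (3) The Lebesgue measure on $\mathbb{R}^n$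 is both left and right invariant on $\mathbb{G}$. $L^p$ is the Lebesgue space $L^p(\mathbb{R}^n,\mathbb{R})$ with respect to Lebesgue measure. *)

theory Defs
  imports "HOL-Analysis.Analysis"
begin

section \<open>Smooth functions\<close>

(* k-times continuous differentiability. Derivatives are taken with "at x", so this is the usual
   C^k only for open S, which is the only way it is used. *)
primrec Ck_on :: "nat \<Rightarrow> 'a::euclidean_space set \<Rightarrow> ('a \<Rightarrow> 'b::real_normed_vector) \<Rightarrow> bool" where
  "Ck_on 0 S f \<longleftrightarrow> continuous_on S f"
| "Ck_on (Suc k) S f \<longleftrightarrow>
     (\<forall>x\<in>S. f differentiable (at x)) \<and>
     (\<forall>v. Ck_on k S (\<lambda>x. frechet_derivative f (at x) v))"

definition smooth_on :: "'a::euclidean_space set \<Rightarrow> ('a \<Rightarrow> 'b::real_normed_vector) \<Rightarrow> bool" where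
  "smooth_on S f \<longleftrightarrow> (\<forall>k. Ck_on k S f)"


section \<open>The differential operator\<close>

definition partial :: "'n \<Rightarrow> (real^'n \<Rightarrow> real) \<Rightarrow> real^'n \<Rightarrow> real" where
  "partial i f x = frechet_derivative f (at x) (axis i 1)"

definition grad :: "(real^'n \<Rightarrow> real) \<Rightarrow> real^'n \<Rightarrow> real^'n" where
  "grad f x = (\<chi> i. partial i f x)"

definition divergence :: "(real^'n \<Rightarrow> real^'n) \<Rightarrow> real^'n \<Rightarrow> real" where
  "divergence F x = (\<Sum>i\<in>UNIV. partial i (\<lambda>y. F y $ i) x)"

definition diffop ::
  "(real^'n \<Rightarrow> real^'n^'n) \<Rightarrow> (real^'n \<Rightarrow> real^'n) \<Rightarrow> (real^'n \<Rightarrow> real) \<Rightarrow> real^'n \<Rightarrow> real" where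
  "diffop A b u x = divergence (\<lambda>y. A y *v grad u y) x + b x \<bullet> grad u x"

(* The formal adjoint of diffop A b for symmetric A: by parts,
   the integral of (diffop A b u) * phi equals that of u * (diffop_adj A b phi)
   for smooth u and test functions phi. *)
definition diffop_adj ::
  "(real^'n \<Rightarrow> real^'n^'n) \<Rightarrow> (real^'n \<Rightarrow> real^'n) \<Rightarrow> (real^'n \<Rightarrow> real) \<Rightarrow> real^'n \<Rightarrow> real" where
  "diffop_adj A b \<phi> x =
     divergence (\<lambda>y. A y *v grad \<phi> y) x - divergence (\<lambda>y. \<phi> y *\<^sub>R b y) x"


section \<open>Distributions and hypoellipticity\<close>

definition support :: "(real^'n \<Rightarrow> real) \<Rightarrow> (real^'n) set" where
  "support \<phi> = closure {x. \<phi> x \<noteq> 0}"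

(* Test functions on \<Omega> are represented by their extension by zero to the whole space. *)
definition test_functions :: "(real^'n) set \<Rightarrow> (real^'n \<Rightarrow> real) set" where
  "test_functions \<Omega> = {\<phi>. smooth_on UNIV \<phi> \<and> compact (support \<phi>) \<and> support \<phi> \<subseteq> \<Omega>}"

(* foldr partial [i1, ..., im] \<phi> is the iterated partial derivative of \<phi> in the directions
   i1, ..., im. Lists instead of multi-indices only repeat summands, since mixed partial
   derivatives of test functions commute. *)
definition Ck_norm :: "nat \<Rightarrow> (real^'n \<Rightarrow> real) \<Rightarrow> real" where
  "Ck_norm k \<phi> = (\<Sum>is\<in>{is. length is \<le> k}. SUP x. \<bar>foldr partial is \<phi> x\<bar>)"

(* Real distributions on the open set \<Omega>; only the values on test_functions \<Omega> matter. *)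
definition distribution_on ::
  "(real^'n) set \<Rightarrow> ((real^'n \<Rightarrow> real) \<Rightarrow> real) \<Rightarrow> bool" where
  "distribution_on \<Omega> T \<longleftrightarrow>
     (\<forall>\<phi>\<in>test_functions \<Omega>. \<forall>\<psi>\<in>test_functions \<Omega>. T (\<lambda>x. \<phi> x + \<psi> x) = T \<phi> + T \<psi>) \<and>
     (\<forall>c. \<forall>\<phi>\<in>test_functions \<Omega>. T (\<lambda>x. c * \<phi> x) = c * T \<phi>) \<and>
     (\<forall>K. compact K \<and> K \<subseteq> \<Omega> \<longrightarrow>
        (\<exists>C k. \<forall>\<phi>\<in>test_functions \<Omega>. support \<phi> \<subseteq> K \<longrightarrow> \<bar>T \<phi>\<bar> \<le> C * Ck_norm k \<phi>))"

definition smooth_distribution_on ::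
  "(real^'n) set \<Rightarrow> ((real^'n \<Rightarrow> real) \<Rightarrow> real) \<Rightarrow> bool" where
  "smooth_distribution_on \<Omega> T \<longleftrightarrow>
     (\<exists>f. smooth_on \<Omega> f \<and> (\<forall>\<phi>\<in>test_functions \<Omega>. T \<phi> = (LINT x:\<Omega>|lebesgue. f x * \<phi> x)))"

definition diffop_distr ::
  "(real^'n \<Rightarrow> real^'n^'n) \<Rightarrow> (real^'n \<Rightarrow> real^'n) \<Rightarrow>
     ((real^'n \<Rightarrow> real) \<Rightarrow> real) \<Rightarrow> (real^'n \<Rightarrow> real) \<Rightarrow> real" where
  "diffop_distr A b T \<phi> = T (diffop_adj A b \<phi>)"

definition hypoelliptic :: "(real^'n \<Rightarrow> real^'n^'n) \<Rightarrow> (real^'n \<Rightarrow> real^'n) \<Rightarrow> bool" where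
  "hypoelliptic A b \<longleftrightarrow>
     (\<forall>\<Omega> T. open \<Omega> \<and> distribution_on \<Omega> T \<and> smooth_distribution_on \<Omega> (diffop_distr A b T)
        \<longrightarrow> smooth_distribution_on \<Omega> T)"


section \<open>Lie groups on Euclidean space\<close>

(* A Lie group whose underlying manifold is R^n with its standard smooth structure. *)
definition lie_group :: "(real^'n \<Rightarrow> real^'n \<Rightarrow> real^'n) \<Rightarrow> bool" where
  "lie_group mul \<longleftrightarrow>
     (\<exists>e inv. Groups.group mul e inv \<and> smooth_on UNIV (\<lambda>(x, y). mul x y) \<and> smooth_on UNIV inv)"

definition left_translation_invariant ::
  "(real^'n \<Rightarrow> real^'n \<Rightarrow> real^'n) \<Rightarrow> ((real^'n \<Rightarrow> real) \<Rightarrow> real^'n \<Rightarrow> real) \<Rightarrow> bool" where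
  "left_translation_invariant mul L \<longleftrightarrow>
     (\<forall>\<alpha> x w. smooth_on UNIV w \<longrightarrow> L (\<lambda>y. w (mul \<alpha> y)) x = L w (mul \<alpha> x))"

definition lebesgue_left_invariant :: "(real^'n \<Rightarrow> real^'n \<Rightarrow> real^'n) \<Rightarrow> bool" where
  "lebesgue_left_invariant mul \<longleftrightarrow>
     (\<forall>\<alpha>. \<forall>E\<in>sets lebesgue. (\<lambda>x. mul \<alpha> x) ` E \<in> sets lebesgue \<and>
        emeasure lebesgue ((\<lambda>x. mul \<alpha> x) ` E) = emeasure lebesgue E)"

definition lebesgue_right_invariant :: "(real^'n \<Rightarrow> real^'n \<Rightarrow> real^'n) \<Rightarrow> bool" where
  "lebesgue_right_invariant mul \<longleftrightarrow>
     (\<forall>\<alpha>. \<forall>E\<in>sets lebesgue. (\<lambda>x. mul x \<alpha>) ` E \<in> sets lebesgue \<and>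
        emeasure lebesgue ((\<lambda>x. mul x \<alpha>) ` E) = emeasure lebesgue E)"


section \<open>Lebesgue spaces\<close>

definition in_Lp :: "real \<Rightarrow> (real^'n \<Rightarrow> real) \<Rightarrow> bool" where
  "in_Lp p u \<longleftrightarrow> u \<in> borel_measurable lebesgue \<and> integrable lebesgue (\<lambda>x. \<bar>u x\<bar> powr p)"

end

theory Submission
  imports Defs
begin

text \<open>
  If \<open>v\<close> is smooth and integrable with \<open>L v \<ge> 0\<close>, then \<open>L v = 0\<close>: average \<open>L v\<close> against all left
  translates of a bump function \<open>\<eta>\<close>; invariance of \<open>L\<close> and bi-invariance of Lebesgue measure turn the
  average into \<open>\<integral> v \<cdot> \<integral> L\<^sup>*\<eta> = \<integral> v \<cdot> \<integral> \<eta> \<cdot> L 1 = 0\<close>. Applied to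
  \<open>v = (sqrt (1 + u\<^sup>2) - 1)\<^sup>m\<close> with \<open>m = \<lfloor>p\<rfloor>\<close>, which is dominated by \<open>\<bar>u\<bar> powr p\<close> and a strictly convex
  function of \<open>u\<close> off \<open>0\<close>, this gives \<open>A \<nabla>u \<bullet> \<nabla>u = 0\<close> wherever \<open>u \<noteq> 0\<close>. Hence every smooth
  function of \<open>u\<^sup>3\<close> is a solution, and in the limit so is, in the sense of distributions,
  \<open>sgn (u\<^sup>3 - c)\<close> for each \<open>c\<close>. Hypoellipticity makes this function smooth, so \<open>u\<close> does not cross
  any level and is constant; a constant in \<open>L\<^sup>p\<close> vanishes.
\<close>

section \<open>Smooth functions\<close>

lemma Ck_on_SucI:
  fixes f :: "'a::euclidean_space \<Rightarrow> 'b::real_normed_vector"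
  assumes "\<And>x. (f has_derivative D x) (at x)" and "\<And>v. Ck_on k UNIV (\<lambda>x. D x v)"
  shows "Ck_on (Suc k) UNIV f"
proof -
  have "frechet_derivative f (at x) = D x" for x
    using assms(1) frechet_derivative_at by metis
  then show ?thesis
    using assms by (auto simp: differentiable_def)
qed

lemma Ck_on_SucD:
  assumes "Ck_on (Suc k) UNIV f"
  shows "(f has_derivative frechet_derivative f (at x)) (at x)"
    and "Ck_on k UNIV (\<lambda>x. frechet_derivative f (at x) v)"
  using assms by (auto simp: frechet_derivative_works)

text \<open>The product and chain rules leave some factors undifferentiated; this brings them down
  to the level \<open>k\<close> of an induction hypothesis.\<close>

lemma Ck_on_Suc_imp_Ck_on: "Ck_on (Suc k) UNIV f \<Longrightarrow> Ck_on k UNIV f"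
proof (induction k arbitrary: f)
  case 0
  then show ?case
    by (auto intro!: differentiable_imp_continuous_on simp: differentiable_on_def)
next
  case (Suc k)
  then show ?case by (metis Ck_on.simps(2))
qed

lemma Ck_on_const: "Ck_on k UNIV (\<lambda>x. c)"
  by (induction k arbitrary: c) (auto intro: Ck_on_SucI[where D = "\<lambda>x v. 0"] simp del: Ck_on.simps(2))

lemma Ck_on_bounded_linear:
  assumes L: "bounded_linear L"
  shows "Ck_on k UNIV f \<Longrightarrow> Ck_on k UNIV (\<lambda>x. L (f x))"
proof (induction k arbitrary: f)
  case 0
  then show ?case using L by (auto intro: bounded_linear.continuous_on)
next
  case (Suc k)
  show ?case
    by (rule Ck_on_SucI[OF bounded_linear.has_derivative[OF L Ck_on_SucD(1)[OF Suc.prems]]])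
      (rule Suc.IH[OF Ck_on_SucD(2)[OF Suc.prems]])
qed

lemma Ck_on_add: "Ck_on k UNIV f \<Longrightarrow> Ck_on k UNIV g \<Longrightarrow> Ck_on k UNIV (\<lambda>x. f x + g x)"
proof (induction k arbitrary: f g)
  case 0
  then show ?case by (auto intro: continuous_intros)
next
  case (Suc k)
  show ?case
    by (rule Ck_on_SucI[OF has_derivative_add[OF Ck_on_SucD(1)[OF Suc.prems(1)] Ck_on_SucD(1)[OF Suc.prems(2)]]])
      (rule Suc.IH[OF Ck_on_SucD(2)[OF Suc.prems(1)] Ck_on_SucD(2)[OF Suc.prems(2)]])
qed

lemma Ck_on_sum:
  "(\<And>i. i \<in> I \<Longrightarrow> Ck_on k UNIV (f i)) \<Longrightarrow> Ck_on k UNIV (\<lambda>x. \<Sum>i\<in>I. f i x)"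
  by (induction I rule: infinite_finite_induct) (auto intro: Ck_on_const Ck_on_add)

text \<open>Every bounded bilinear map obeys the product rule, so one induction covers products,
  inner products and scalar multiples.\<close>

lemma Ck_on_bounded_bilinear:
  assumes B: "bounded_bilinear B"
  shows "Ck_on k UNIV f \<Longrightarrow> Ck_on k UNIV g \<Longrightarrow> Ck_on k UNIV (\<lambda>x. B (f x) (g x))"
proof (induction k arbitrary: f g)
  case 0
  then show ?case using B by (auto intro: bounded_bilinear.continuous_on)
next
  case (Suc k)
  show ?case
    by (rule Ck_on_SucI[OF bounded_bilinear.FDERIV[OF B Ck_on_SucD(1)[OF Suc.prems(1)] Ck_on_SucD(1)[OF Suc.prems(2)]]])
      (intro Ck_on_add Suc.IH Ck_on_Suc_imp_Ck_on[OF Suc.prems(1)] Ck_on_Suc_imp_Ck_on[OF Suc.prems(2)]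
        Ck_on_SucD(2)[OF Suc.prems(1)] Ck_on_SucD(2)[OF Suc.prems(2)])
qed

lemma Ck_on_compose:
  fixes f :: "'a::euclidean_space \<Rightarrow> 'b::euclidean_space" and g :: "'b \<Rightarrow> 'c::real_normed_vector"
  shows "Ck_on k UNIV f \<Longrightarrow> Ck_on k UNIV g \<Longrightarrow> Ck_on k UNIV (\<lambda>x. g (f x))"
proof (induction k arbitrary: f g)
  case 0
  then show ?case
    by (auto intro: continuous_on_compose2)
next
  case (Suc k)
  let ?Df = "\<lambda>x. frechet_derivative f (at x)" and ?Dg = "\<lambda>y. frechet_derivative g (at y)"
  have f: "(f has_derivative ?Df x) (at x)" and g: "(g has_derivative ?Dg y) (at y)" for x y
    using Ck_on_SucD(1) Suc.prems by blast+
  have D: "((\<lambda>x. g (f x)) has_derivative (\<lambda>v. ?Dg (f x) (?Df x v))) (at x)" for x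
    using diff_chain_at[OF f g] by (simp add: o_def)
  \<comment> \<open>\<open>Ck_on\<close> differentiates in fixed directions only, but here the
    direction \<open>?Df x v\<close> moves with \<open>x\<close>. Expanding it in the basis gives a
    sum of products of C^k functions.\<close>
  have expand: "?Dg (f x) (?Df x v) = (\<Sum>e\<in>Basis. (?Df x v \<bullet> e) *\<^sub>R ?Dg (f x) e)" for x v
  proof -
    have "?Dg (f x) (\<Sum>e\<in>Basis. (?Df x v \<bullet> e) *\<^sub>R e) = (\<Sum>e\<in>Basis. (?Df x v \<bullet> e) *\<^sub>R ?Dg (f x) e)"
      using has_derivative_linear[OF g] by (simp add: linear_sum linear_scale)
    then show ?thesis by (simp add: euclidean_representation)
  qed
  show ?case
  proof (rule Ck_on_SucI[OF D])
    show "Ck_on k UNIV (\<lambda>x. ?Dg (f x) (?Df x v))" for v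
      unfolding expand
      by (intro Ck_on_sum Ck_on_bounded_bilinear[OF bounded_bilinear_scaleR]
          Ck_on_bounded_linear[OF bounded_linear_inner_left] Ck_on_SucD(2)[OF Suc.prems(1)]
          Suc.IH[OF Ck_on_Suc_imp_Ck_on[OF Suc.prems(1)] Ck_on_SucD(2)[OF Suc.prems(2)]])
  qed
qed

lemma smooth_on_imp_Ck_on: "smooth_on S f \<Longrightarrow> Ck_on k S f"
  by (simp add: smooth_on_def)

lemma smooth_on_imp_continuous_on: "smooth_on S f \<Longrightarrow> continuous_on S f"
  using smooth_on_imp_Ck_on[of S f 0] by simp

lemma smooth_on_imp_has_derivative:
  "smooth_on UNIV f \<Longrightarrow> (f has_derivative frechet_derivative f (at x)) (at x)"
  by (rule Ck_on_SucD(1)[OF smooth_on_imp_Ck_on])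

lemma smooth_on_frechet_derivative:
  "smooth_on UNIV f \<Longrightarrow> smooth_on UNIV (\<lambda>x. frechet_derivative f (at x) v)"
  unfolding smooth_on_def by (metis Ck_on_SucD(2))

lemma smooth_on_const: "smooth_on UNIV (\<lambda>x. c)"
  by (simp add: smooth_on_def Ck_on_const)

lemma smooth_on_bounded_linear:
  "bounded_linear L \<Longrightarrow> smooth_on UNIV f \<Longrightarrow> smooth_on UNIV (\<lambda>x. L (f x))"
  by (simp add: smooth_on_def Ck_on_bounded_linear)

lemma smooth_on_add:
  "smooth_on UNIV f \<Longrightarrow> smooth_on UNIV g \<Longrightarrow> smooth_on UNIV (\<lambda>x. f x + g x)"
  by (simp add: smooth_on_def Ck_on_add)

lemma smooth_on_sum:
  "(\<And>i. i \<in> I \<Longrightarrow> smooth_on UNIV (f i)) \<Longrightarrow> smooth_on UNIV (\<lambda>x. \<Sum>i\<in>I. f i x)"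
  by (simp add: smooth_on_def Ck_on_sum)

lemma smooth_on_bounded_bilinear:
  "bounded_bilinear B \<Longrightarrow> smooth_on UNIV f \<Longrightarrow> smooth_on UNIV g \<Longrightarrow> smooth_on UNIV (\<lambda>x. B (f x) (g x))"
  by (simp add: smooth_on_def Ck_on_bounded_bilinear)

lemmas smooth_on_mult = smooth_on_bounded_bilinear[OF bounded_bilinear_mult]
  and smooth_on_inner = smooth_on_bounded_bilinear[OF bounded_bilinear_inner]

lemma smooth_on_compose:
  fixes f :: "'a::euclidean_space \<Rightarrow> 'b::euclidean_space" and g :: "'b \<Rightarrow> 'c::real_normed_vector"
  shows "smooth_on UNIV g \<Longrightarrow> smooth_on UNIV f \<Longrightarrow> smooth_on UNIV (\<lambda>x. g (f x))"
  by (simp add: smooth_on_def Ck_on_compose)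

lemma smooth_on_bounded_linear_map:
  assumes "bounded_linear f"
  shows "smooth_on UNIV f"
proof -
  have "Ck_on k UNIV f" for k
  proof (cases k)
    case 0
    then show ?thesis
      using assms by (simp add: linear_continuous_on)
  next
    case (Suc m)
    then show ?thesis
      using Ck_on_SucI[OF bounded_linear_imp_has_derivative[OF assms] Ck_on_const] by simp
  qed
  then show ?thesis by (simp add: smooth_on_def)
qed

lemmas smooth_on_id = smooth_on_bounded_linear_map[OF bounded_linear_ident]

lemma smooth_on_diff:
  "smooth_on UNIV f \<Longrightarrow> smooth_on UNIV g \<Longrightarrow> smooth_on UNIV (\<lambda>x. f x - g x)"
  using smooth_on_add[of f "\<lambda>x. - g x"] smooth_on_bounded_linear[OF bounded_linear_minus[OF bounded_linear_ident], of g]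
  by simp

lemma smooth_on_power:
  fixes f :: "'a::euclidean_space \<Rightarrow> real"
  shows "smooth_on UNIV f \<Longrightarrow> smooth_on UNIV (\<lambda>x. f x ^ m)"
  by (induction m) (auto intro: smooth_on_const smooth_on_mult)

lemma smooth_on_Pair:
  assumes "smooth_on UNIV f" "smooth_on UNIV g"
  shows "smooth_on UNIV (\<lambda>x. (f x, g x))"
proof -
  have "bounded_linear (\<lambda>y. (y, 0))" "bounded_linear (\<lambda>y. (0, y))"
    by (simp_all add: bounded_linear_Pair bounded_linear_ident bounded_linear_zero)
  from smooth_on_add[OF smooth_on_bounded_linear[OF this(1) assms(1)] smooth_on_bounded_linear[OF this(2) assms(2)]]
  show ?thesis by simp
qed

lemmas smooth_on_intros =
  smooth_on_const smooth_on_id smooth_on_add smooth_on_diff smooth_on_mult smooth_on_power smooth_on_sum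

section \<open>Smooth functions of one real variable\<close>

lemma Ck_on_Suc_realI:
  fixes f :: "real \<Rightarrow> real"
  assumes "\<And>t. (f has_real_derivative f' t) (at t)" and "Ck_on k UNIV f'"
  shows "Ck_on (Suc k) UNIV f"
proof (rule Ck_on_SucI)
  show "(f has_derivative (*) (f' t)) (at t)" for t
    using assms(1) by (simp add: has_field_derivative_def)
  show "Ck_on k UNIV (\<lambda>t. f' t * v)" for v
    by (intro Ck_on_bounded_bilinear[OF bounded_bilinear_mult] assms Ck_on_const)
qed

text \<open>Bootstrapping: the derivative may be expressed through the function itself.\<close>

lemma smooth_on_real_bootstrap:
  fixes f :: "real \<Rightarrow> real"
  assumes deriv: "\<And>t. (f has_real_derivative f' t) (at t)"
    and boot: "\<And>k. Ck_on k UNIV f \<Longrightarrow> Ck_on k UNIV f'"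
  shows "smooth_on UNIV f"
proof -
  have "Ck_on k UNIV f" for k
  proof (induction k)
    case 0
    then show ?case
      using deriv by (auto intro!: continuous_at_imp_continuous_on DERIV_isCont)
  next
    case (Suc k)
    then show ?case by (rule Ck_on_Suc_realI[OF deriv boot])
  qed
  then show ?thesis by (simp add: smooth_on_def)
qed

lemma DERIV_inverse_sqrt_one_plus_sq:
  "((\<lambda>t::real. 1 / sqrt (1 + t\<^sup>2)) has_real_derivative - t * (1 / sqrt (1 + t\<^sup>2)) ^ 3) (at t)"
proof -
  have "0 < 1 + t\<^sup>2" by (simp add: add_pos_nonneg)
  then show ?thesis
    by (auto intro!: derivative_eq_intros simp: field_simps power3_eq_cube)
qed

text \<open>Writing \<open>r\<close> for the function, its derivative \<open>- t * r ^ 3\<close> is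
  a polynomial in \<open>t\<close> and \<open>r\<close>, which is what bootstrapping
  requires.\<close>

lemma smooth_inverse_sqrt_one_plus_sq: "smooth_on UNIV (\<lambda>t::real. 1 / sqrt (1 + t\<^sup>2))"
proof (rule smooth_on_real_bootstrap[OF DERIV_inverse_sqrt_one_plus_sq])
  fix k
  assume "Ck_on k UNIV (\<lambda>t::real. 1 / sqrt (1 + t\<^sup>2))"
  then show "Ck_on k UNIV (\<lambda>t::real. - t * (1 / sqrt (1 + t\<^sup>2)) ^ 3)"
    unfolding power3_eq_cube
    by (intro Ck_on_bounded_bilinear[OF bounded_bilinear_mult]
        smooth_on_imp_Ck_on[OF smooth_on_bounded_linear_map[OF bounded_linear_minus[OF bounded_linear_ident]]])
qed

lemma DERIV_sqrt_one_plus_sq: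
  "((\<lambda>t::real. sqrt (1 + t\<^sup>2)) has_real_derivative t * (1 / sqrt (1 + t\<^sup>2))) (at t)"
proof -
  have "0 < 1 + t\<^sup>2" by (simp add: add_pos_nonneg)
  then show ?thesis
    by (auto intro!: derivative_eq_intros simp: field_simps)
qed

lemma smooth_sqrt_one_plus_sq: "smooth_on UNIV (\<lambda>t::real. sqrt (1 + t\<^sup>2))"
  by (rule smooth_on_real_bootstrap[OF DERIV_sqrt_one_plus_sq])
    (intro smooth_on_imp_Ck_on smooth_on_intros smooth_inverse_sqrt_one_plus_sq)

lemma smooth_algebraic_sigmoid: "smooth_on UNIV (\<lambda>t::real. t * (1 / sqrt (1 + t\<^sup>2)))"
  by (intro smooth_on_intros smooth_inverse_sqrt_one_plus_sq)

lemma DERIV_algebraic_sigmoid: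
  "((\<lambda>t::real. t * (1 / sqrt (1 + t\<^sup>2))) has_real_derivative (1 / sqrt (1 + t\<^sup>2)) ^ 3) (at t)"
proof -
  define r where "r = 1 / sqrt (1 + t\<^sup>2)"
  have "r\<^sup>2 * (1 + t\<^sup>2) = 1"
    by (simp add: r_def power_divide add_nonneg_eq_0_iff)
  \<comment> \<open>Factor out \<open>r\<close>: the relation above says
    \<open>1 - t\<^sup>2 * r\<^sup>2 = r\<^sup>2\<close>.\<close>
  then have "r + (- t * r ^ 3) * t = r ^ 3"
    by algebra
  moreover have "((\<lambda>t::real. t * (1 / sqrt (1 + t\<^sup>2))) has_real_derivative r + (- t * r ^ 3) * t) (at t)"
    using DERIV_mult[OF DERIV_ident DERIV_inverse_sqrt_one_plus_sq, of t] by (simp add: r_def)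
  ultimately show ?thesis by (simp add: r_def)
qed

text \<open>The case \<open>n = 0\<close> is Cauchy's flat function. The powers of
  \<open>1 / t\<close> are built in because the span of this family is closed under
  differentiation.\<close>

definition flat_exp :: "nat \<Rightarrow> real \<Rightarrow> real" where
  "flat_exp n t = (if t > 0 then (1 / t) ^ n * exp (- (1 / t)) else 0)"

lemma flat_exp_tendsto_0: "(flat_exp n \<longlongrightarrow> 0) (at_right 0)"
proof -
  have "((\<lambda>x. x ^ n / exp x) \<longlongrightarrow> 0) (at_top :: real filter)"
    by (rule tendsto_power_div_exp_0)
  then have "((\<lambda>t::real. (inverse t) ^ n / exp (inverse t)) \<longlongrightarrow> 0) (at_right 0)"
    by (rule filterlim_compose) (rule filterlim_inverse_at_top_right)
  then show ?thesis
    by (rule Lim_transform_eventually)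
      (auto simp: flat_exp_def eventually_at_right_field exp_minus field_simps intro!: exI[of _ 1])
qed

lemma DERIV_flat_exp:
  "(flat_exp n has_real_derivative flat_exp (n + 2) t - real n * flat_exp (n + 1) t) (at t)"
proof -
  consider "t > 0" | "t < 0" | "t = 0" by linarith
  then show ?thesis
  proof cases
    case 1
    have inv: "((\<lambda>t. 1 / t) has_real_derivative - ((1 / t)\<^sup>2)) (at t)"
      using 1 by (auto intro!: derivative_eq_intros simp: power2_eq_square)
    have "((\<lambda>t. exp (- (1 / t))) has_real_derivative exp (- (1 / t)) * (1 / t)\<^sup>2) (at t)"
      using DERIV_fun_exp[OF DERIV_minus[OF inv]] by simp
    from DERIV_mult[OF DERIV_power[OF inv, of n] this]
    have "((\<lambda>t. (1 / t) ^ n * exp (- (1 / t))) has_real_derivative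
        (1 / t) ^ n * (exp (- (1 / t)) * (1 / t)\<^sup>2)
          + real n * (- ((1 / t)\<^sup>2) * (1 / t) ^ (n - Suc 0)) * exp (- (1 / t))) (at t)"
      by (simp add: mult.commute add.commute)
    \<comment> \<open>The exponent \<open>n - Suc 0\<close> is truncated at \<open>n = 0\<close>,
      where the factor \<open>real n\<close> removes the term; hence the case split on
      \<open>n\<close>.\<close>
    also have "(1 / t) ^ n * (exp (- (1 / t)) * (1 / t)\<^sup>2)
          + real n * (- ((1 / t)\<^sup>2) * (1 / t) ^ (n - Suc 0)) * exp (- (1 / t))
        = flat_exp (n + 2) t - real n * flat_exp (n + 1) t"
      using 1 by (cases n) (simp_all only: flat_exp_def if_True power_add power2_eq_square power_Suc power_one_right of_nat_0 mult_zero_left diff_Suc_Suc diff_zero, simp_all add: mult_ac)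
    finally have D: "((\<lambda>t. (1 / t) ^ n * exp (- (1 / t))) has_real_derivative
        flat_exp (n + 2) t - real n * flat_exp (n + 1) t) (at t)" .
    have ev: "\<forall>\<^sub>F s in nhds t. (1 / s) ^ n * exp (- (1 / s)) = flat_exp n s"
      using eventually_nhds_in_open[OF open_greaterThan[of 0], of t] 1
      by (auto elim!: eventually_mono simp: flat_exp_def)
    show ?thesis
      by (rule DERIV_cong_ev[OF refl ev refl, THEN iffD1, OF D])
  next
    case 2
    have ev: "\<forall>\<^sub>F s in nhds t. 0 = flat_exp n s"
      using eventually_nhds_in_open[OF open_lessThan[of 0], of t] 2
      by (auto elim!: eventually_mono simp: flat_exp_def)
    have D: "((\<lambda>t. 0) has_real_derivative flat_exp (n + 2) t - real n * flat_exp (n + 1) t) (at t)"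
      using 2 by (simp add: flat_exp_def)
    show ?thesis
      by (rule DERIV_cong_ev[OF refl ev refl, THEN iffD1, OF D])
  next
    case 3
    \<comment> \<open>From the right the difference quotient at 0 is the next member
      \<open>flat_exp (Suc n)\<close> of the family; from the left it is 0.\<close>
    have "((\<lambda>s. flat_exp n s / s) \<longlongrightarrow> 0) (at_right 0)"
      by (rule Lim_transform_eventually[OF flat_exp_tendsto_0[of "Suc n"]])
        (auto simp: flat_exp_def eventually_at_right_field intro!: exI[of _ 1])
    moreover have "((\<lambda>s. flat_exp n s / s) \<longlongrightarrow> 0) (at_left 0)"
      by (rule tendsto_eventually)
        (auto simp: flat_exp_def eventually_at_left_field intro!: exI[of _ "-1"])
    ultimately have "((\<lambda>s. flat_exp n s / s) \<longlongrightarrow> 0) (at 0)"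
      by (auto intro: filterlim_split_at)
    then show ?thesis
      using 3 by (simp add: has_field_derivative_iff flat_exp_def)
  qed
qed

lemma smooth_flat_exp: "smooth_on UNIV (flat_exp n)"
proof -
  \<comment> \<open>\<open>n\<close> must stay arbitrary in the induction, as the derivative
    involves the members \<open>n + 1\<close> and \<open>n + 2\<close>.\<close>
  have "Ck_on k UNIV (flat_exp n)" for k
  proof (induction k arbitrary: n)
    case 0
    then show ?case
      using DERIV_flat_exp by (auto intro!: continuous_at_imp_continuous_on DERIV_isCont)
  next
    case (Suc k)
    have "Ck_on k UNIV (\<lambda>t. flat_exp (n + 2) t + (- real n) * flat_exp (n + 1) t)"
      by (intro Ck_on_add Ck_on_bounded_bilinear[OF bounded_bilinear_mult] Ck_on_const Suc)
    then show ?case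
      by (intro Ck_on_Suc_realI[OF DERIV_flat_exp]) simp
  qed
  then show ?thesis by (simp add: smooth_on_def)
qed

section \<open>Test functions and partial derivatives\<close>

lemma exists_bump:
  fixes a :: "real^'n"
  assumes "r > 0"
  obtains \<phi> where "\<phi> \<in> test_functions UNIV" "\<And>x. \<phi> x \<ge> 0" "\<And>x. \<phi> x > 0 \<longleftrightarrow> x \<in> ball a r"
proof -
  \<comment> \<open>The squared distance makes the argument a polynomial, hence smooth at the centre
    too; it is positive exactly on the ball.\<close>
  define \<phi> where "\<phi> x = flat_exp 0 (r\<^sup>2 - (x - a) \<bullet> (x - a))" for x
  have "smooth_on UNIV \<phi>"
    unfolding \<phi>_def
    by (intro smooth_on_compose[OF smooth_flat_exp] smooth_on_intros smooth_on_inner)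
  moreover have pos: "\<phi> x > 0 \<longleftrightarrow> x \<in> ball a r" for x
  proof -
    have "\<phi> x > 0 \<longleftrightarrow> (norm (x - a))\<^sup>2 < r\<^sup>2"
      by (simp add: \<phi>_def flat_exp_def power2_norm_eq_inner)
    also have "\<dots> \<longleftrightarrow> norm (x - a) < r"
      using assms power_mono_iff[of r "norm (x - a)" 2] by (auto simp: not_le[symmetric])
    finally show ?thesis by (simp add: dist_norm norm_minus_commute)
  qed
  moreover have nonneg: "\<phi> x \<ge> 0" for x
    by (simp add: \<phi>_def flat_exp_def)
  moreover have "compact (support \<phi>)"
  proof -
    have "{x. \<phi> x \<noteq> 0} = ball a r"
      using pos nonneg by (force simp: less_le)
    then show ?thesis
      using assms by (simp add: support_def)
  qed
  ultimately show ?thesis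
    by (intro that[of \<phi>]) (auto simp: test_functions_def)
qed

section \<open>Supports and rules for partial derivatives\<close>

lemma not_in_support: "x \<notin> support \<phi> \<Longrightarrow> \<phi> x = 0"
  using closure_subset[of "{x. \<phi> x \<noteq> 0}"] by (auto simp: support_def)

lemma partial_eqI: "(f has_derivative D) (at x) \<Longrightarrow> partial i f x = D (axis i 1)"
  unfolding partial_def by (metis frechet_derivative_at)

lemma smooth_on_partial: "smooth_on UNIV f \<Longrightarrow> smooth_on UNIV (partial i f)"
  using smooth_on_frechet_derivative[of f "axis i 1"] by (simp add: partial_def[abs_def])

lemma partial_add:
  assumes "smooth_on UNIV f" "smooth_on UNIV g"
  shows "partial i (\<lambda>y. f y + g y) x = partial i f x + partial i g x"
  using partial_eqI[OF has_derivative_add[OF assms[THEN smooth_on_imp_has_derivative]]]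
  by (simp add: partial_def)

lemma partial_diff:
  assumes "smooth_on UNIV f" "smooth_on UNIV g"
  shows "partial i (\<lambda>y. f y - g y) x = partial i f x - partial i g x"
  using partial_eqI[OF has_derivative_diff[OF assms[THEN smooth_on_imp_has_derivative]]]
  by (simp add: partial_def)

lemma partial_mult:
  assumes "smooth_on UNIV f" "smooth_on UNIV g"
  shows "partial i (\<lambda>y. f y * g y) x = f x * partial i g x + partial i f x * g x"
  using partial_eqI[OF has_derivative_mult[OF assms[THEN smooth_on_imp_has_derivative]]]
  by (simp add: partial_def)

lemma partial_const: "partial i (\<lambda>y. c) x = 0"
  by (simp add: partial_eqI[OF has_derivative_const])

lemma partial_compose:
  assumes "smooth_on UNIV f" "\<And>t. (F has_real_derivative F' t) (at t)"
  shows "partial i (\<lambda>y. F (f y)) x = F' (f x) * partial i f x"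
proof -
  have "((\<lambda>y. F (f y)) has_derivative (\<lambda>v. F' (f x) * frechet_derivative f (at x) v)) (at x)"
    using diff_chain_at[OF smooth_on_imp_has_derivative[OF assms(1)], of F "(*) (F' (f x))" x] assms(2)
    by (simp add: o_def has_field_derivative_def)
  then show ?thesis
    by (simp add: partial_eqI[of _ _ x] partial_def[of i f])
qed

lemma partial_eq_0_outside:
  assumes "closed K" "\<And>x. x \<notin> K \<Longrightarrow> f x = 0" "x \<notin> K"
  shows "partial i f x = 0"
proof -
  have "((\<lambda>y. 0) has_derivative (\<lambda>v. 0)) (at x)"
    by simp
  then have "(f has_derivative (\<lambda>v. 0)) (at x)"
    by (rule has_derivative_transform_within_open[of _ _ _ _ "- K"]) (use assms in auto)
  then show ?thesis by (simp add: partial_eqI)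
qed

section \<open>Integrals of compactly supported functions\<close>

lemma integrable_continuous_compact_support:
  fixes f :: "'a::euclidean_space \<Rightarrow> real"
  assumes "continuous_on UNIV f" "compact K" "\<And>x. x \<notin> K \<Longrightarrow> f x = 0"
  shows "integrable lborel f"
proof -
  have "integrable lborel (\<lambda>x. indicator K x *\<^sub>R f x)"
    using assms by (intro borel_integrable_compact) (auto intro: continuous_on_subset)
  moreover have "(\<lambda>x. indicator K x *\<^sub>R f x) = f"
    by (rule ext) (use assms(3) in \<open>auto simp: indicator_def\<close>)
  ultimately show ?thesis by simp
qed

lemma continuous_compact_support_bounded:
  fixes f :: "'a::euclidean_space \<Rightarrow> real"
  assumes "continuous_on UNIV f" "compact K" "\<And>x. x \<notin> K \<Longrightarrow> f x = 0"
  obtains M where "M > 0" "\<And>x. \<bar>f x\<bar> \<le> M"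
proof -
  have "bounded (f ` K)"
    by (intro compact_imp_bounded compact_continuous_image assms continuous_on_subset[OF assms(1)]) auto
  then obtain M where M: "M > 0" "\<And>x. x \<in> K \<Longrightarrow> \<bar>f x\<bar> \<le> M"
    unfolding bounded_pos by auto
  have "\<bar>f x\<bar> \<le> M" for x
    using M assms(3) by (cases "x \<in> K") auto
  then show ?thesis using M that by blast
qed

text \<open>The difference quotients of \<open>g\<close> have integral 0 by translation invariance, and
  they converge to the partial derivative under a common integrable bound.\<close>

lemma integral_partial_eq_0:
  fixes g :: "real^'n \<Rightarrow> real"
  assumes g: "smooth_on UNIV g" and K: "compact K" "\<And>x. x \<notin> K \<Longrightarrow> g x = 0"
  shows "integral\<^sup>L lborel (partial i g) = 0"
proof -
  define e :: "real^'n" where "e = axis i 1"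
  have e: "norm e = 1" by (simp add: e_def)
  \<comment> \<open>Step sizes at most 1 keep the supports of all difference quotients in one ball
    of radius \<open>R + 1\<close>.\<close>
  define h where "h k = inverse (real (Suc k))" for k
  have h: "0 < h k" "h k \<le> 1" for k
    by (auto simp: h_def inverse_le_1_iff)
  have h0: "h \<longlonglongrightarrow> 0"
    unfolding h_def using LIMSEQ_inverse_real_of_nat by simp
  have cont: "continuous_on UNIV g" "continuous_on UNIV (partial i g)"
    using g smooth_on_partial smooth_on_imp_continuous_on by blast+
  have [measurable]: "g \<in> borel_measurable borel" "partial i g \<in> borel_measurable borel"
    using cont by (auto intro: borel_measurable_continuous_onI)
  have int_g: "integrable lborel g"
    by (rule integrable_continuous_compact_support[OF cont(1) K])
  obtain M where M: "M > 0" "\<And>x. \<bar>partial i g x\<bar> \<le> M"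
    using continuous_compact_support_bounded[OF cont(2) K(1)
        partial_eq_0_outside[OF compact_imp_closed[OF K(1)] K(2)]] by blast
  obtain R where R: "\<And>x. x \<in> K \<Longrightarrow> norm x \<le> R"
    using compact_imp_bounded[OF K(1)] unfolding bounded_iff by auto
  have deriv: "((\<lambda>t. g (x + t *\<^sub>R e)) has_real_derivative partial i g (x + t *\<^sub>R e)) (at t)" for x t
  proof -
    have "((\<lambda>t. x + t *\<^sub>R e) has_derivative (\<lambda>s. s *\<^sub>R e)) (at t)"
      by (auto intro!: derivative_eq_intros)
    from diff_chain_at[OF this smooth_on_imp_has_derivative[OF g]]
    have "((\<lambda>t. g (x + t *\<^sub>R e)) has_derivative
        (\<lambda>s. frechet_derivative g (at (x + t *\<^sub>R e)) (s *\<^sub>R e))) (at t)"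
      by (simp add: o_def)
    moreover have "frechet_derivative g (at (x + t *\<^sub>R e)) (s *\<^sub>R e) = partial i g (x + t *\<^sub>R e) * s" for s
      using linear_scale[OF has_derivative_linear[OF smooth_on_imp_has_derivative[OF g]]]
      by (simp add: partial_def e_def)
    ultimately show ?thesis by (simp add: has_field_derivative_def)
  qed
  define s where "s k x = (g (x + h k *\<^sub>R e) - g x) / h k" for k x
  \<comment> \<open>Inside the ball the mean value theorem turns the quotient into a partial
    derivative at an intermediate point. Outside it, \<open>x\<close> and the shifted point both
    miss \<open>K\<close>.\<close>
  have bound: "\<bar>s k x\<bar> \<le> M * indicator (cball 0 (R + 1)) x" for k x
  proof (cases "norm x \<le> R + 1")
    case True
    obtain z where z: "g (x + h k *\<^sub>R e) - g (x + 0 *\<^sub>R e) = (h k - 0) * partial i g (x + z *\<^sub>R e)"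
      using MVT2[OF h(1)[of k] deriv] by blast
    then have "s k x = partial i g (x + z *\<^sub>R e)"
      using h(1)[of k] by (simp add: s_def)
    then show ?thesis using M True by simp
  next
    case False
    have "norm x \<le> norm (x + h k *\<^sub>R e) + norm (h k *\<^sub>R e)"
      by (metis add_diff_cancel_right' norm_triangle_ineq4)
    then have "norm (x + h k *\<^sub>R e) > R"
      using False h[of k] e by simp
    then have "x \<notin> K" "x + h k *\<^sub>R e \<notin> K"
      using R False by force+
    then show ?thesis by (simp add: s_def K(2) M(1) less_imp_le)
  qed
  have int_s: "integral\<^sup>L lborel (s k) = 0" for k
  proof -
    have "integral\<^sup>L lborel g = integral\<^sup>L (distr lborel borel ((+) (h k *\<^sub>R e))) g"
      by (simp add: lborel_distr_plus)
    also have "\<dots> = (LINT x|lborel. g (x + h k *\<^sub>R e))"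
      by (subst integral_distr) (auto simp: add.commute)
    finally have eq: "(LINT x|lborel. g (x + h k *\<^sub>R e)) = integral\<^sup>L lborel g" by simp
    have "integrable (distr lborel borel ((+) (h k *\<^sub>R e))) g"
      using int_g by (simp add: lborel_distr_plus)
    then have "integrable lborel (\<lambda>x. g (x + h k *\<^sub>R e))"
      by (subst (asm) integrable_distr_eq) (auto simp: add.commute)
    then show ?thesis
      using int_g eq by (simp add: s_def[abs_def])
  qed
  have "(\<lambda>k. integral\<^sup>L lborel (s k)) \<longlonglongrightarrow> integral\<^sup>L lborel (partial i g)"
  proof (rule integral_dominated_convergence)
    show "integrable lborel (\<lambda>x. M * indicator (cball 0 (R + 1)) x :: real)"
      by (intro integrable_mult_right integrable_real_indicator)
        (use emeasure_lborel_cball_finite in \<open>auto simp: less_top\<close>)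
    show "AE x in lborel. norm (s k x) \<le> M * indicator (cball 0 (R + 1)) x" for k
      using bound by simp
    show "AE x in lborel. (\<lambda>k. s k x) \<longlonglongrightarrow> partial i g x"
    proof (rule AE_I2)
      fix x
      have "((\<lambda>d. (g (x + d *\<^sub>R e) - g x) / d) \<longlongrightarrow> partial i g x) (at 0)"
        using deriv[of x 0] by (simp add: DERIV_def)
      moreover have "filterlim h (at 0) sequentially"
        using h0 h(1) by (auto simp: filterlim_at less_imp_neq[symmetric])
      ultimately show "(\<lambda>k. s k x) \<longlonglongrightarrow> partial i g x"
        unfolding s_def by (rule filterlim_compose)
    qed
  qed (auto simp: s_def[abs_def])
  then show ?thesis
    by (simp add: int_s LIMSEQ_const_iff)
qed

section \<open>The operator and its adjoint\<close>

locale smooth_diffop =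
  fixes A :: "real^'n \<Rightarrow> real^'n^'n" and b :: "real^'n \<Rightarrow> real^'n"
  assumes A_smooth: "\<And>i j. smooth_on UNIV (\<lambda>x. A x $ i $ j)"
    and b_smooth: "\<And>j. smooth_on UNIV (\<lambda>x. b x $ j)"
    and A_symmetric: "\<And>x. transpose (A x) = A x"
begin

abbreviation L :: "(real^'n \<Rightarrow> real) \<Rightarrow> real^'n \<Rightarrow> real" where
  "L \<equiv> diffop A b"

abbreviation L_adj :: "(real^'n \<Rightarrow> real) \<Rightarrow> real^'n \<Rightarrow> real" where
  "L_adj \<equiv> diffop_adj A b"

definition flux :: "'n \<Rightarrow> (real^'n \<Rightarrow> real) \<Rightarrow> real^'n \<Rightarrow> real" where
  "flux i u x = (A x *v grad u x) $ i"

text \<open>The carre du champ of \<open>L\<close>: it measures by how much \<open>L\<close> fails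
  the chain rule of a first-order operator.\<close>

definition energy :: "(real^'n \<Rightarrow> real) \<Rightarrow> real^'n \<Rightarrow> real" where
  "energy u x = (A x *v grad u x) \<bullet> grad u x"

lemma flux_eq_sum: "flux i u x = (\<Sum>j\<in>UNIV. A x $ i $ j * partial j u x)"
  by (simp add: flux_def matrix_vector_mult_def grad_def)

lemma L_eq_sum: "L u x = (\<Sum>i\<in>UNIV. partial i (flux i u) x) + (\<Sum>i\<in>UNIV. b x $ i * partial i u x)"
  by (simp add: diffop_def divergence_def flux_def[abs_def] inner_vec_def grad_def)

lemma L_adj_eq_sum:
  "L_adj u x = (\<Sum>i\<in>UNIV. partial i (flux i u) x) - (\<Sum>i\<in>UNIV. partial i (\<lambda>y. u y * b y $ i) x)"
  by (simp add: diffop_adj_def divergence_def flux_def[abs_def])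

lemma energy_eq_sum: "energy u x = (\<Sum>i\<in>UNIV. flux i u x * partial i u x)"
  by (simp add: energy_def inner_vec_def flux_def grad_def)

text \<open>Symmetry of \<open>A\<close> enters here; it cancels the products of two first
  derivatives when integrating by parts.\<close>

lemma flux_symmetric:
  "(\<Sum>i\<in>UNIV. flux i u x * partial i v x) = (\<Sum>i\<in>UNIV. flux i v x * partial i u x)"
proof -
  have "(A x *v grad u x) \<bullet> grad v x = (A x *v grad v x) \<bullet> grad u x"
    using dot_lmul_matrix[of "grad u x" "A x" "grad v x"] transpose_matrix_vector[of "A x" "grad u x"]
    by (simp add: A_symmetric inner_commute)
  then show ?thesis
    by (simp add: inner_vec_def flux_def grad_def)
qed

lemma smooth_on_flux: "smooth_on UNIV u \<Longrightarrow> smooth_on UNIV (flux i u)"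
  unfolding flux_eq_sum[abs_def] by (intro smooth_on_intros A_smooth smooth_on_partial)

lemma smooth_on_L: "smooth_on UNIV u \<Longrightarrow> smooth_on UNIV (L u)"
  unfolding L_eq_sum[abs_def] by (intro smooth_on_intros b_smooth smooth_on_partial smooth_on_flux)

lemma smooth_on_L_adj: "smooth_on UNIV u \<Longrightarrow> smooth_on UNIV (L_adj u)"
  unfolding L_adj_eq_sum[abs_def] by (intro smooth_on_intros b_smooth smooth_on_partial smooth_on_flux)

lemma flux_const: "flux i (\<lambda>y. c) = (\<lambda>y. 0)"
  by (rule ext) (simp add: flux_eq_sum partial_const)

lemma L_const: "L (\<lambda>y. c) x = 0"
  by (simp add: L_eq_sum flux_const partial_const)

lemma flux_eq_0_outside:
  assumes "closed K" "\<And>x. x \<notin> K \<Longrightarrow> f x = 0" "x \<notin> K"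
  shows "flux i f x = 0"
  by (simp add: flux_eq_sum partial_eq_0_outside[OF assms])

lemma L_adj_eq_0_outside:
  assumes "closed K" "\<And>x. x \<notin> K \<Longrightarrow> f x = 0" "x \<notin> K"
  shows "L_adj f x = 0"
proof -
  have "partial i (flux i f) x = 0" "partial i (\<lambda>y. f y * b y $ i) x = 0" for i
    by (rule partial_eq_0_outside[OF assms(1) _ assms(3)], simp add: flux_eq_0_outside[OF assms(1,2)] assms(2))+
  then show ?thesis by (simp add: L_adj_eq_sum)
qed

lemma flux_compose:
  assumes "smooth_on UNIV u" "\<And>t. (F has_real_derivative F' t) (at t)"
  shows "flux i (\<lambda>y. F (u y)) x = F' (u x) * flux i u x"
  by (simp add: flux_eq_sum partial_compose[OF assms] sum_distrib_left mult_ac)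

text \<open>The flux of \<open>F (u y)\<close> is \<open>F' (u y)\<close> times the flux of
  \<open>u\<close>; differentiating this factor once more produces the energy term, while the drift
  contributes only to the first term.\<close>

lemma L_compose:
  assumes u: "smooth_on UNIV u" and F': "smooth_on UNIV F'"
    and F: "\<And>t. (F has_real_derivative F' t) (at t)"
    and F'': "\<And>t. (F' has_real_derivative F'' t) (at t)"
  shows "L (\<lambda>y. F (u y)) x = F' (u x) * L u x + F'' (u x) * energy u x"
proof -
  have "flux i (\<lambda>y. F (u y)) = (\<lambda>y. F' (u y) * flux i u y)" for i
    by (rule ext) (rule flux_compose[OF u F])
  then have "partial i (flux i (\<lambda>y. F (u y))) x
      = F' (u x) * partial i (flux i u) x + F'' (u x) * (flux i u x * partial i u x)" for i
    by (simp add: partial_mult smooth_on_compose[OF F' u] smooth_on_flux[OF u] partial_compose[OF u F''])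
  then show ?thesis
    by (simp add: L_eq_sum energy_eq_sum partial_compose[OF u F] sum.distrib sum_distrib_left algebra_simps)
qed

lemma energy_compose:
  assumes "smooth_on UNIV u" "\<And>t. (F has_real_derivative F' t) (at t)"
  shows "energy (\<lambda>y. F (u y)) x = (F' (u x))\<^sup>2 * energy u x"
  by (simp add: energy_eq_sum flux_compose[OF assms] partial_compose[OF assms] sum_distrib_left
      power2_eq_square mult_ac)

text \<open>Green's identity: \<open>L v x * \<phi> x - v x * L_adj \<phi> x\<close> is the
  divergence of the field \<open>G\<close>. Each term of \<open>G\<close> contains
  \<open>\<phi>\<close> or its flux, so \<open>G\<close> vanishes off \<open>K\<close> and its
  divergence integrates to 0, whatever \<open>v\<close> does at infinity.\<close>

lemma integral_by_parts:
  assumes v: "smooth_on UNIV v" and \<phi>: "smooth_on UNIV \<phi>"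
    and K: "compact K" "\<And>x. x \<notin> K \<Longrightarrow> \<phi> x = 0"
  shows "(LINT x|lborel. v x * L_adj \<phi> x) = (LINT x|lborel. L v x * \<phi> x)"
proof -
  define G where "G i y = \<phi> y * flux i v y - v y * flux i \<phi> y + v y * (\<phi> y * b y $ i)" for i y
  have closed: "closed K" using K(1) by (rule compact_imp_closed)
  have G: "smooth_on UNIV (G i)" for i
    unfolding G_def by (intro smooth_on_intros v \<phi> b_smooth smooth_on_flux)
  have G0: "G i x = 0" if "x \<notin> K" for i x
    using that by (simp add: G_def K(2) flux_eq_0_outside[OF closed K(2)])
  have partial_G: "partial i (G i) x =
      \<phi> x * partial i (flux i v) x - v x * partial i (flux i \<phi>) x + v x * partial i (\<lambda>y. \<phi> y * b y $ i) x
      + flux i v x * partial i \<phi> x - flux i \<phi> x * partial i v x + b x $ i * partial i v x * \<phi> x" for i x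
    unfolding G_def
    by (simp add: partial_add partial_diff partial_mult smooth_on_intros v \<phi> b_smooth smooth_on_flux algebra_simps)
  have sum: "(\<Sum>i\<in>UNIV. partial i (G i) x) = L v x * \<phi> x - v x * L_adj \<phi> x" for x
    unfolding partial_G sum.distrib sum_subtractf flux_symmetric[of \<phi> x v] L_eq_sum L_adj_eq_sum
    by (simp add: sum_distrib_left sum_distrib_right algebra_simps)
  have int: "integrable lborel f" if "smooth_on UNIV f" "\<And>x. x \<notin> K \<Longrightarrow> f x = 0" for f :: "real^'n \<Rightarrow> real"
    using that by (intro integrable_continuous_compact_support[OF _ K(1)] smooth_on_imp_continuous_on)
  have "integrable lborel (partial i (G i))" for i
    by (intro int smooth_on_partial G partial_eq_0_outside[OF closed G0])
  then have "(LINT x|lborel. (\<Sum>i\<in>UNIV. partial i (G i) x)) = (\<Sum>i\<in>UNIV. integral\<^sup>L lborel (partial i (G i)))"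
    by (rule Bochner_Integration.integral_sum)
  also have "\<dots> = 0"
    by (simp add: integral_partial_eq_0[OF G K(1) G0])
  finally have "(LINT x|lborel. L v x * \<phi> x - v x * L_adj \<phi> x) = 0"
    by (simp add: sum)
  moreover have "integrable lborel (\<lambda>x. L v x * \<phi> x)"
    by (intro int smooth_on_intros smooth_on_L v \<phi>) (simp add: K)
  moreover have "integrable lborel (\<lambda>x. v x * L_adj \<phi> x)"
    by (intro int smooth_on_intros smooth_on_L_adj v \<phi>) (simp add: L_adj_eq_0_outside[OF closed K(2)])
  ultimately show ?thesis by simp
qed

end

section \<open>Integrable subsolutions\<close>

lemma AE_lborel_continuous_imp_eq_0:
  fixes f :: "'a::euclidean_space \<Rightarrow> real"
  assumes "continuous_on UNIV f" "AE x in lborel. f x = 0"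
  shows "f x = 0"
proof -
  have "{x. f x \<noteq> 0} \<in> null_sets lborel"
    using assms(2) borel_measurable_continuous_onI[OF assms(1)]
    by (subst AE_iff_null_sets) auto
  moreover have "open {x. f x \<noteq> 0}"
    using assms(1) by (intro open_Collect_neq) auto
  ultimately have "{x. f x \<noteq> 0} = {}"
    using open_not_negligible[of "{x. f x \<noteq> 0}"] null_sets_completionI[of "{x. f x \<noteq> 0}" lborel]
    by (auto simp: negligible_iff_null_sets)
  then show ?thesis by auto
qed

lemma continuous_nonneg_integral_eq_0_iff:
  fixes f :: "'a::euclidean_space \<Rightarrow> real"
  assumes "continuous_on UNIV f" "integrable lborel f" "\<And>x. 0 \<le> f x" "integral\<^sup>L lborel f = 0"
  shows "f x = 0"
  using assms integral_nonneg_eq_0_iff_AE[of lborel f] AE_lborel_continuous_imp_eq_0[of f x]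
  by auto

text \<open>The group invariance is stated for images of sets, whereas \<open>distr\<close> measures
  preimages; the preimage under \<open>T\<close> is the image under its inverse
  \<open>T'\<close>.\<close>

lemma distr_lborel_eqI:
  fixes T T' :: "'a::euclidean_space \<Rightarrow> 'a"
  assumes cont: "continuous_on UNIV T" and inv: "\<And>x. T' (T x) = x" "\<And>x. T (T' x) = x"
    and inv_meas: "\<And>E. E \<in> sets lebesgue \<Longrightarrow> emeasure lebesgue (T' ` E) = emeasure lebesgue E"
  shows "distr lborel borel T = lborel"
proof (rule measure_eqI)
  have T: "T \<in> borel_measurable borel"
    using cont by (rule borel_measurable_continuous_onI)
  fix E assume "E \<in> sets (distr lborel borel T)"
  then have E: "E \<in> sets borel" by simp
  have "T -` E = T' ` E"
  proof (intro equalityI subsetI)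
    show "x \<in> T' ` E" if "x \<in> T -` E" for x
      using that by (intro image_eqI[of _ _ "T x"]) (simp_all add: inv)
  qed (auto simp: inv)
  moreover have "T -` E \<in> sets borel"
    using measurable_sets[OF T E] by simp
  ultimately have "emeasure lborel (T -` E) = emeasure lebesgue (T' ` E)"
    by simp
  also have "\<dots> = emeasure lborel E"
    using inv_meas[of E] E by simp
  finally show "emeasure (distr lborel borel T) E = emeasure lborel E"
    using T E by (simp add: emeasure_distr)
qed simp

lemma
  fixes T :: "'a::euclidean_space \<Rightarrow> 'a" and f :: "'a \<Rightarrow> real"
  assumes distr: "distr lborel borel T = lborel" and T: "continuous_on UNIV T" and f: "continuous_on UNIV f"
  shows integral_lborel_compose: "(LINT x|lborel. f (T x)) = integral\<^sup>L lborel f"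
    and integrable_lborel_compose: "integrable lborel f \<Longrightarrow> integrable lborel (\<lambda>x. f (T x))"
proof -
  have meas: "T \<in> borel_measurable lborel" "f \<in> borel_measurable borel"
    using T f by (auto intro: borel_measurable_continuous_onI)
  show "(LINT x|lborel. f (T x)) = integral\<^sup>L lborel f"
    using integral_distr[OF meas] by (simp add: distr)
  show "integrable lborel f \<Longrightarrow> integrable lborel (\<lambda>x. f (T x))"
    using integrable_distr_eq[OF meas] by (simp add: distr)
qed

section \<open>Translations on the group\<close>

locale invariant_diffop = smooth_diffop A b + G: Groups.group mul e inv
  for A :: "real^'n \<Rightarrow> real^'n^'n" and b :: "real^'n \<Rightarrow> real^'n"
    and mul :: "real^'n \<Rightarrow> real^'n \<Rightarrow> real^'n" and e and inv +
  assumes mul_smooth: "smooth_on UNIV (\<lambda>(x, y). mul x y)"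
    and left_inv: "left_translation_invariant mul L"
    and leb_left: "lebesgue_left_invariant mul"
    and leb_right: "lebesgue_right_invariant mul"
begin

lemma smooth_on_left_translation: "smooth_on UNIV (mul y)"
  using smooth_on_compose[OF mul_smooth smooth_on_Pair[OF smooth_on_const[of y] smooth_on_id]]
  by simp

text \<open>The swapped arguments fit the Fubini integrand \<open>v x * \<psi> (mul y x)\<close> as
  a function of \<open>(x, y)\<close>.\<close>

lemma continuous_mul: "continuous_on UNIV (\<lambda>p. mul (snd p) (fst p))"
  using continuous_on_compose2[OF smooth_on_imp_continuous_on[OF mul_smooth], of UNIV prod.swap]
  by (simp add: case_prod_beta continuous_on_swap)

lemma continuous_right_translation: "continuous_on UNIV (\<lambda>y. mul y x)"
  using continuous_on_compose2[OF continuous_mul, of UNIV "\<lambda>y. (x, y)"]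
  by (simp add: continuous_on_Pair continuous_on_const continuous_on_id)

lemma distr_left_translation: "distr lborel borel (mul y) = lborel"
proof (rule distr_lborel_eqI[where T' = "mul (inv y)"])
  show "emeasure lebesgue ((mul (inv y)) ` E) = emeasure lebesgue E" if "E \<in> sets lebesgue" for E
    using leb_left that unfolding lebesgue_left_invariant_def by blast
qed (simp_all add: G.assoc[symmetric] smooth_on_left_translation smooth_on_imp_continuous_on)

lemma distr_right_translation: "distr lborel borel (\<lambda>y. mul y x) = lborel"
proof (rule distr_lborel_eqI[where T' = "\<lambda>y. mul y (inv x)"])
  show "emeasure lebesgue ((\<lambda>y. mul y (inv x)) ` E) = emeasure lebesgue E" if "E \<in> sets lebesgue" for E
    using leb_right that unfolding lebesgue_right_invariant_def by blast
qed (simp_all add: G.assoc continuous_right_translation)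

lemma integrable_subsolution_is_solution:
  assumes v: "smooth_on UNIV v" and int_v: "integrable lborel v" and sub: "\<And>x. 0 \<le> L v x"
  shows "L v x\<^sub>0 = 0"
proof -
  obtain \<eta> :: "real^'n \<Rightarrow> real" where \<eta>: "\<eta> \<in> test_functions UNIV" "\<And>x. \<eta> x \<ge> 0" "\<And>x. \<eta> x > 0 \<longleftrightarrow> x \<in> ball 0 1"
    using exists_bump[of 1 0] by auto
  define K where "K = support \<eta>"
  have \<eta>_smooth: "smooth_on UNIV \<eta>" and K: "compact K" "\<And>x. x \<notin> K \<Longrightarrow> \<eta> x = 0"
    using \<eta>(1) not_in_support by (auto simp: test_functions_def K_def)
  define \<psi> where "\<psi> = L_adj \<eta>"
  have cont: "continuous_on UNIV v" "continuous_on UNIV (L v)" "continuous_on UNIV \<eta>" "continuous_on UNIV \<psi>"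
    and cont_mul: "continuous_on UNIV (mul y)" for y
    using v \<eta>_smooth smooth_on_L smooth_on_L_adj smooth_on_left_translation smooth_on_imp_continuous_on
    unfolding \<psi>_def by blast+
  have int_\<psi>: "integrable lborel \<psi>"
    using integrable_continuous_compact_support[OF cont(4) K(1)]
      L_adj_eq_0_outside[OF compact_imp_closed[OF K(1)] K(2)] by (simp add: \<psi>_def)
  \<comment> \<open>Integration by parts against the constant 1, which \<open>L\<close>
    annihilates.\<close>
  have \<psi>0: "integral\<^sup>L lborel \<psi> = 0"
    using integral_by_parts[OF smooth_on_const \<eta>_smooth K, of 1] by (simp add: L_const \<psi>_def)
  define h where "h y = (LINT x|lborel. L v x * \<eta> (mul y x))" for y
  \<comment> \<open>Substitute \<open>z = mul y x\<close>, pull the translation inside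
    \<open>L\<close> by left invariance, move \<open>L\<close> onto \<open>\<eta>\<close>, and
    substitute back.\<close>
  have h_eq: "h y = (LINT x|lborel. v x * \<psi> (mul y x))" for y
  proof -
    have cancel: "mul (inv y) (mul y x) = x" for x
      by (simp add: G.assoc[symmetric])
    have "h y = (LINT z|lborel. L v (mul (inv y) z) * \<eta> z)"
      using integral_lborel_compose[OF distr_left_translation cont_mul, of "\<lambda>z. L v (mul (inv y) z) * \<eta> z" y]
        cont_mul cont by (simp add: cancel h_def continuous_on_mult continuous_on_compose2)
    also have "\<dots> = (LINT z|lborel. L (\<lambda>z. v (mul (inv y) z)) z * \<eta> z)"
      using left_inv v by (simp add: left_translation_invariant_def)
    also have "\<dots> = (LINT z|lborel. v (mul (inv y) z) * \<psi> z)"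
      unfolding \<psi>_def
      by (rule integral_by_parts[symmetric, OF smooth_on_compose[OF v smooth_on_left_translation] \<eta>_smooth K])
    also have "\<dots> = (LINT x|lborel. v x * \<psi> (mul y x))"
      using integral_lborel_compose[OF distr_left_translation cont_mul, of "\<lambda>z. v (mul (inv y) z) * \<psi> z" y]
        cont_mul cont by (simp add: cancel continuous_on_mult continuous_on_compose2)
    finally show ?thesis .
  qed
  \<comment> \<open>For fixed \<open>x\<close>, the map \<open>y \<mapsto> mul y x\<close> is a
    right translation, so the integrals over \<open>y\<close> do not depend on
    \<open>x\<close>.\<close>
  have int_right: "integrable lborel (\<lambda>y. \<psi> (mul y x))"
    and integral_right: "(LINT y|lborel. \<psi> (mul y x)) = 0"
    and integral_abs_right: "(LINT y|lborel. \<bar>\<psi> (mul y x)\<bar>) = (LINT y|lborel. \<bar>\<psi> y\<bar>)" for x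
    using integrable_lborel_compose[OF distr_right_translation continuous_right_translation cont(4) int_\<psi>]
      integral_lborel_compose[OF distr_right_translation continuous_right_translation cont(4)]
      integral_lborel_compose[OF distr_right_translation continuous_right_translation continuous_on_rabs[OF cont(4)]]
    by (simp_all add: \<psi>0)
  \<comment> \<open>The inner integral of the absolute value is \<open>\<bar>v x\<bar>\<close> times
    the L^1 norm of \<open>\<psi>\<close>, which is integrable in \<open>x\<close>.\<close>
  have Fubini: "integrable (lborel \<Otimes>\<^sub>M lborel) (\<lambda>(x, y). v x * \<psi> (mul y x))"
  proof (rule lborel_pair.Fubini_integrable)
    have "continuous_on UNIV (\<lambda>p. v (fst p) * \<psi> (mul (snd p) (fst p)))"
      by (intro continuous_on_mult continuous_on_compose2[OF cont(1)] continuous_on_compose2[OF cont(4)]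
          continuous_mul continuous_on_fst continuous_on_id) auto
    then show "(\<lambda>(x, y). v x * \<psi> (mul y x)) \<in> borel_measurable (lborel \<Otimes>\<^sub>M lborel)"
      by (simp add: lborel_prod case_prod_beta borel_measurable_continuous_onI)
    show "integrable lborel (\<lambda>x. LINT y|lborel. norm (case (x, y) of (x, y) \<Rightarrow> v x * \<psi> (mul y x)))"
      using int_v by (simp add: abs_mult integral_abs_right)
    show "AE x in lborel. integrable lborel (\<lambda>y. case (x, y) of (x, y) \<Rightarrow> v x * \<psi> (mul y x))"
      by (simp add: int_right)
  qed
  have "integrable lborel h"
    using lborel_pair.integrable_snd[OF Fubini] by (simp add: h_eq[abs_def])
  moreover have "integral\<^sup>L lborel h = 0"
    using lborel_pair.Fubini_integral[OF Fubini] by (simp add: h_eq[abs_def] integral_right)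
  moreover have "0 \<le> h y" for y
    unfolding h_def by (intro Bochner_Integration.integral_nonneg) (simp add: sub \<eta>(2))
  ultimately have AE_h: "AE y in lborel. h y = 0"
    by (simp add: integral_nonneg_eq_0_iff_AE)
  \<comment> \<open>\<open>h\<close> vanishes only almost everywhere, so a suitable \<open>y\<close>
    has to be found among the translations for which the bump is nonzero at
    \<open>x\<^sub>0\<close>; otherwise a continuous function would vanish almost everywhere but not
    everywhere.\<close>
  have "\<exists>y. h y = 0 \<and> \<eta> (mul y x\<^sub>0) \<noteq> 0"
  proof (rule ccontr)
    assume "\<not> ?thesis"
    then have "AE y in lborel. \<eta> (mul y x\<^sub>0) = 0"
      using AE_h by (auto elim: eventually_mono)
    \<comment> \<open>Right multiplication by \<open>x\<^sub>0\<close> sends this point to the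
      vector 0, the centre of the bump; 0 is not assumed to be the group identity
      \<open>e\<close>.\<close>
    then have "\<eta> (mul (mul 0 (inv x\<^sub>0)) x\<^sub>0) = 0"
      by (intro AE_lborel_continuous_imp_eq_0[where f = "\<lambda>y. \<eta> (mul y x\<^sub>0)"]
          continuous_on_compose2[OF cont(3) continuous_right_translation]) auto
    then show False
      using \<eta>(3)[of 0] by (simp add: G.assoc)
  qed
  then obtain y where y: "h y = 0" "\<eta> (mul y x\<^sub>0) \<noteq> 0" by blast
  have "L v x\<^sub>0 * \<eta> (mul y x\<^sub>0) = 0"
  proof (rule continuous_nonneg_integral_eq_0_iff[where f = "\<lambda>x. L v x * \<eta> (mul y x)"])
    show cont': "continuous_on UNIV (\<lambda>x. L v x * \<eta> (mul y x))"
      by (intro continuous_on_mult cont continuous_on_compose2[OF cont(3) cont_mul]) auto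
    \<comment> \<open>The translated bump lives on the left translate of \<open>K\<close> by
      \<open>inv y\<close>.\<close>
    have "compact (mul (inv y) ` K)"
      by (intro compact_continuous_image continuous_on_subset[OF cont_mul] K) auto
    moreover have "mul y x \<notin> K" if "x \<notin> mul (inv y) ` K" for x
      using that by (metis G.assoc G.left_inverse G.left_neutral image_eqI)
    ultimately show "integrable lborel (\<lambda>x. L v x * \<eta> (mul y x))"
      by (intro integrable_continuous_compact_support[OF cont']) (auto simp: K(2))
    show "(LINT x|lborel. L v x * \<eta> (mul y x)) = 0"
      using y(1) by (simp add: h_def)
  qed (simp add: sub \<eta>(2))
  then show ?thesis using y(2) by simp
qed

end

section \<open>Solutions in Lebesgue spaces\<close>

lemma (in invariant_diffop) energy_eq_0_of_Lp_solution:
  assumes A_nonneg: "\<And>x \<xi>. (A x *v \<xi>) \<bullet> \<xi> \<ge> 0"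
    and p: "1 \<le> p" and u_Lp: "in_Lp p u"
    and u: "smooth_on UNIV u" and u_sol: "\<And>x. L u x = 0"
    and nz: "u x\<^sub>0 \<noteq> 0"
  shows "energy u x\<^sub>0 = 0"
proof -
  have energy_nonneg: "energy f x \<ge> 0" for f x
    by (simp add: energy_def A_nonneg)
  \<comment> \<open>An integer power keeps \<open>v\<close> smooth. \<open>S t ^ m\<close> is of
    order \<open>2 * m\<close> at 0 and \<open>m\<close> at infinity, so domination needs
    \<open>m \<le> p \<le> 2 * m\<close>; the upper bound holds because \<open>p < m + 1\<close> and
    \<open>1 \<le> m\<close>.\<close>
  define m where "m = nat \<lfloor>p\<rfloor>"
  have m: "1 \<le> m" "real m \<le> p" "p \<le> 2 * real m"
  proof -
    have "1 \<le> \<lfloor>p\<rfloor>" using p by simp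
    then show "1 \<le> m" "real m \<le> p" "p \<le> 2 * real m"
      unfolding m_def by linarith+
  qed
  \<comment> \<open>A smooth convex substitute for \<open>\<bar>t\<bar>\<close>: quadratic at 0,
    linear at infinity.\<close>
  define S where "S t = sqrt (1 + t\<^sup>2) - 1" for t :: real
  have S_nonneg: "0 \<le> S t" for t by (simp add: S_def)
  have S_pos: "0 < S t" if "t \<noteq> 0" for t using that by (simp add: S_def)
  have S_le: "S t \<le> \<bar>t\<bar>" "S t \<le> \<bar>t\<bar>\<^sup>2" for t
  proof -
    have "sqrt (1 + t\<^sup>2) \<le> 1 + \<bar>t\<bar>"
      by (rule real_le_lsqrt) (auto simp: power2_eq_square algebra_simps)
    then show "S t \<le> \<bar>t\<bar>" by (simp add: S_def)
    have "1 + t\<^sup>2 \<le> (1 + t\<^sup>2)\<^sup>2"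
      by (simp add: power2_sum)
    then have "sqrt (1 + t\<^sup>2) \<le> 1 + t\<^sup>2"
      by (intro real_le_lsqrt) auto
    then show "S t \<le> \<bar>t\<bar>\<^sup>2" by (simp add: S_def)
  qed
  have S_bound: "S t ^ m \<le> \<bar>t\<bar> powr p" for t
  proof (cases "\<bar>t\<bar> \<le> 1")
    case True
    have "S t ^ m \<le> (\<bar>t\<bar>\<^sup>2) ^ m"
      by (intro power_mono S_le S_nonneg)
    also have "\<dots> \<le> \<bar>t\<bar> powr p"
    proof (cases "t = 0")
      case False
      then have "(\<bar>t\<bar>\<^sup>2) ^ m = \<bar>t\<bar> powr (2 * real m)"
        using powr_realpow[of "\<bar>t\<bar>" "2 * m"] by (simp add: power_mult)
      also have "\<dots> \<le> \<bar>t\<bar> powr p"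
        using True False m by (intro powr_mono') auto
      finally show ?thesis .
    qed (use m in \<open>simp add: power_0_left\<close>)
    finally show ?thesis .
  next
    case False
    have "S t ^ m \<le> \<bar>t\<bar> ^ m"
      by (intro power_mono S_le S_nonneg)
    also have "\<dots> = \<bar>t\<bar> powr real m"
      using False by (simp add: powr_realpow)
    also have "\<dots> \<le> \<bar>t\<bar> powr p"
      using False m by (intro powr_mono) auto
    finally show ?thesis .
  qed
  \<comment> \<open>\<open>t * r t\<close> and \<open>r t ^ 3\<close> are the first two derivatives
    of \<open>S\<close>; positivity of the second is the strict convexity.\<close>
  define r where "r t = 1 / sqrt (1 + t\<^sup>2)" for t :: real
  have r_pos: "r t > 0" for t
    by (simp add: r_def add_pos_nonneg)
  have S_smooth: "smooth_on UNIV S" and dS_smooth: "smooth_on UNIV (\<lambda>t. t * r t)"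
    unfolding S_def[abs_def] r_def
    by (intro smooth_on_intros smooth_sqrt_one_plus_sq smooth_algebraic_sigmoid)+
  have dS: "(S has_real_derivative t * r t) (at t)" for t
    using DERIV_diff[OF DERIV_sqrt_one_plus_sq[of t] DERIV_const[of 1]] by (simp add: S_def[abs_def] r_def)
  have ddS: "((\<lambda>t. t * r t) has_real_derivative r t ^ 3) (at t)" for t
    using DERIV_algebraic_sigmoid by (simp add: r_def)
  define w where "w x = S (u x)" for x
  have w: "smooth_on UNIV w"
    unfolding w_def[abs_def] by (rule smooth_on_compose[OF S_smooth u])
  have Lw: "L w x = r (u x) ^ 3 * energy u x" for x
    unfolding w_def[abs_def] using L_compose[OF u dS_smooth dS ddS] by (simp add: u_sol)
  define v where "v x = w x ^ m" for x
  have v: "smooth_on UNIV v"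
    unfolding v_def[abs_def] by (intro smooth_on_intros w)
  \<comment> \<open>For \<open>m = 1\<close> the exponent \<open>m - 2\<close> is truncated, but the
    factor \<open>real (m - 1)\<close> then removes the term.\<close>
  have Lv: "L v x = real m * w x ^ (m - 1) * L w x + real m * real (m - 1) * w x ^ (m - 2) * energy w x" for x
  proof -
    have d: "((\<lambda>t. t ^ m) has_real_derivative real m * t ^ (m - 1)) (at t)"
      "((\<lambda>t. real m * t ^ (m - 1)) has_real_derivative real m * (real (m - 1) * t ^ (m - 2))) (at t)" for t
      using DERIV_pow[of m t] DERIV_cmult[OF DERIV_pow[of "m - 1" t], of "real m"]
      by (simp_all add: numeral_2_eq_2)
    show ?thesis
      unfolding v_def[abs_def]
      using L_compose[OF w _ d, of x] by (simp add: smooth_on_intros mult.assoc)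
  qed
  have w_nonneg: "0 \<le> w x" for x by (simp add: w_def S_nonneg)
  have Lv_ge: "real m * w x ^ (m - 1) * L w x \<le> L v x" for x
    unfolding Lv by (simp add: w_nonneg energy_nonneg)
  have Lw_nonneg: "0 \<le> real m * w x ^ (m - 1) * L w x" for x
    unfolding Lw using r_pos[of "u x"] by (simp add: w_nonneg energy_nonneg)
  have "integrable lebesgue (\<lambda>x. \<bar>u x\<bar> powr p)"
    using u_Lp by (simp add: in_Lp_def)
  moreover have [measurable]: "u \<in> borel_measurable borel"
    using u by (intro borel_measurable_continuous_onI smooth_on_imp_continuous_on)
  ultimately have "integrable lborel (\<lambda>x. \<bar>u x\<bar> powr p)"
    by (subst (asm) integrable_completion) auto
  then have "integrable lborel v"
  proof (rule Bochner_Integration.integrable_bound)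
    show "v \<in> borel_measurable lborel"
      using v by (simp add: borel_measurable_continuous_onI smooth_on_imp_continuous_on)
    show "AE x in lborel. norm (v x) \<le> norm (\<bar>u x\<bar> powr p)"
      using S_bound by (simp add: v_def w_def S_nonneg)
  qed
  then have "L v x\<^sub>0 = 0"
    using integrable_subsolution_is_solution[OF v] Lv_ge Lw_nonneg order_trans by blast
  \<comment> \<open>This term lies between 0 and \<open>L v x\<^sub>0 = 0\<close>. Its factors other
    than the energy are positive, since \<open>u x\<^sub>0 \<noteq> 0\<close>.\<close>
  then have "real m * w x\<^sub>0 ^ (m - 1) * L w x\<^sub>0 = 0"
    using Lv_ge[of x\<^sub>0] Lw_nonneg[of x\<^sub>0] by linarith
  then show ?thesis
    using m S_pos[OF nz] r_pos[of "u x\<^sub>0"] by (simp add: Lw w_def)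
qed

section \<open>Distributions given by functions\<close>

lemma Ck_norm_0: "Ck_norm 0 \<phi> = (SUP x. \<bar>\<phi> x\<bar>)"
  by (simp add: Ck_norm_def)

text \<open>Such a distribution has order 0: on \<open>K\<close> the estimate holds with the measure
  of \<open>K\<close> as constant.\<close>

lemma distribution_on_bounded_function:
  fixes f :: "real^'n \<Rightarrow> real"
  assumes f: "f \<in> borel_measurable borel" and bound: "\<And>x. \<bar>f x\<bar> \<le> 1"
  shows "distribution_on UNIV (\<lambda>\<phi>. LINT x|lborel. f x * \<phi> x)"
proof -
  have cont: "continuous_on UNIV \<phi>" and K: "compact (support \<phi>)" if "\<phi> \<in> test_functions UNIV" for \<phi> :: "real^'n \<Rightarrow> real"
    using that by (auto simp: test_functions_def smooth_on_imp_continuous_on)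
  have int: "integrable lborel (\<lambda>x. f x * \<phi> x)" if "\<phi> \<in> test_functions UNIV" for \<phi>
  proof (rule Bochner_Integration.integrable_bound)
    show "integrable lborel \<phi>"
      by (rule integrable_continuous_compact_support[OF cont K not_in_support]) (use that in auto)
    show "(\<lambda>x. f x * \<phi> x) \<in> borel_measurable lborel"
      using f borel_measurable_continuous_onI[OF cont[OF that]] by simp
    show "AE x in lborel. norm (f x * \<phi> x) \<le> norm (\<phi> x)"
      using bound by (simp add: abs_mult mult_left_le_one_le)
  qed
  have "\<bar>LINT x|lborel. f x * \<phi> x\<bar> \<le> measure lborel K * Ck_norm 0 \<phi>"
    if "compact K" "\<phi> \<in> test_functions UNIV" "support \<phi> \<subseteq> K" for K \<phi>
  proof -
    have zero: "\<phi> x = 0" if "x \<notin> K" for x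
      using that \<open>support \<phi> \<subseteq> K\<close> not_in_support by blast
    \<comment> \<open>Boundedness of \<open>\<phi>\<close> is what makes the supremum in
      \<open>Ck_norm 0 \<phi>\<close> an upper bound of its values.\<close>
    obtain M where "M > 0" "\<And>x. \<bar>\<phi> x\<bar> \<le> M"
      using continuous_compact_support_bounded[where f = \<phi>, OF cont \<open>compact K\<close> zero]
        \<open>\<phi> \<in> test_functions UNIV\<close> by blast
    then have le: "\<bar>\<phi> x\<bar> \<le> Ck_norm 0 \<phi>" for x
      unfolding Ck_norm_0 by (intro cSUP_upper) (auto intro: bdd_aboveI2[of _ _ M])
    have finite: "emeasure lborel K < \<infinity>" and K_meas: "K \<in> sets borel"
      using emeasure_compact_finite[OF \<open>compact K\<close>] borel_closed[OF compact_imp_closed[OF \<open>compact K\<close>]]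
      by simp_all
    have "norm (LINT x|lborel. f x * \<phi> x) \<le> (LINT x|lborel. Ck_norm 0 \<phi> * indicator K x)"
    proof (rule Bochner_Integration.integral_norm_bound_integral)
      show "integrable lborel (\<lambda>x. Ck_norm 0 \<phi> * indicator K x :: real)"
        using finite K_meas by (intro integrable_mult_right integrable_real_indicator) auto
      show "norm (f x * \<phi> x) \<le> Ck_norm 0 \<phi> * indicator K x" for x
      proof (cases "x \<in> K")
        case True
        have "\<bar>f x * \<phi> x\<bar> \<le> 1 * Ck_norm 0 \<phi>"
          unfolding abs_mult by (intro mult_mono bound le) auto
        then show ?thesis using True by simp
      qed (simp add: zero)
    qed (use int that in auto)
    also have "\<dots> = measure lborel K * Ck_norm 0 \<phi>"
      using K_meas finite by (simp add: less_top[symmetric])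
    finally show ?thesis by simp
  qed
  moreover have "(LINT x|lborel. f x * (c * \<phi> x)) = c * (LINT x|lborel. f x * \<phi> x)" for c \<phi>
    by (simp add: mult.left_commute)
  moreover have "(LINT x|lborel. f x * (\<phi> x + \<psi> x)) = (LINT x|lborel. f x * \<phi> x) + (LINT x|lborel. f x * \<psi> x)"
    if "\<phi> \<in> test_functions UNIV" "\<psi> \<in> test_functions UNIV" for \<phi> \<psi>
    using int that by (simp add: distrib_left)
  ultimately show ?thesis
    unfolding distribution_on_def by blast
qed

text \<open>The fundamental lemma of the calculus of variations, localized to \<open>U\<close>: a
  bump placed where \<open>d\<close> keeps the sign of \<open>d x\<close> would have a nonzero
  integral against \<open>d\<close>. The factor \<open>d x\<close> in the proof treats both signs at
  once.\<close>

lemma continuous_eq_0_if_orthogonal_to_test_functions: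
  fixes d :: "real^'n \<Rightarrow> real"
  assumes d: "continuous_on UNIV d" and U: "open U" "x \<in> U"
    and orth: "\<And>\<phi>. \<phi> \<in> test_functions UNIV \<Longrightarrow> (\<And>y. y \<notin> U \<Longrightarrow> \<phi> y = 0) \<Longrightarrow> (LINT y|lborel. d y * \<phi> y) = 0"
  shows "d x = 0"
proof (rule ccontr)
  assume nz: "d x \<noteq> 0"
  define V where "V = {y. 0 < d x * d y} \<inter> U"
  have "open V"
    unfolding V_def using d U by (intro open_Int open_Collect_less) (auto intro: continuous_intros)
  moreover have "x \<in> V"
    using nz U by (auto simp: V_def zero_less_mult_iff)
  ultimately obtain \<epsilon> where \<epsilon>: "\<epsilon> > 0" "ball x \<epsilon> \<subseteq> V"
    by (auto simp: open_contains_ball)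
  obtain \<phi> :: "real^'n \<Rightarrow> real" where \<phi>: "\<phi> \<in> test_functions UNIV" "\<And>y. \<phi> y \<ge> 0" "\<And>y. \<phi> y > 0 \<longleftrightarrow> y \<in> ball x \<epsilon>"
    using exists_bump[OF \<epsilon>(1)] by blast
  have \<phi>0: "\<phi> y = 0" if "y \<notin> V" for y
    using \<phi>(2)[of y] \<phi>(3)[of y] \<epsilon>(2) that by (auto simp: less_le)
  have cont: "continuous_on UNIV (\<lambda>y. d x * (d y * \<phi> y))"
    using \<phi>(1) d by (intro continuous_intros) (auto simp: test_functions_def smooth_on_imp_continuous_on)
  have "d x * (d x * \<phi> x) = 0"
  proof (rule continuous_nonneg_integral_eq_0_iff[where f = "\<lambda>y. d x * (d y * \<phi> y)", OF cont])
    show "integrable lborel (\<lambda>y. d x * (d y * \<phi> y))"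
      using \<phi>(1) not_in_support
      by (intro integrable_continuous_compact_support[OF cont, of "support \<phi>"]) (auto simp: test_functions_def)
    show "0 \<le> d x * (d y * \<phi> y)" for y
    proof (cases "y \<in> V")
      case True
      then have "0 \<le> d x * d y" by (simp add: V_def)
      then have "0 \<le> (d x * d y) * \<phi> y"
        using \<phi>(2) by (rule mult_nonneg_nonneg)
      then show ?thesis by (simp add: mult.assoc)
    qed (simp add: \<phi>0)
    show "(LINT y|lborel. d x * (d y * \<phi> y)) = 0"
      using orth[OF \<phi>(1)] \<phi>0 by (simp add: V_def)
  qed
  then show False
    using nz \<phi>(3)[of x] \<epsilon>(1) by simp
qed

text \<open>The functions \<open>\<sigma> (k (w - c))\<close> with \<open>\<sigma> t = t / sqrt (1 + t\<^sup>2)\<close> are solutions, and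
  they converge to \<open>sgn (w - c)\<close>, which is therefore a distributional solution. By hypoellipticity
  it is a smooth function, so it cannot jump.\<close>

lemma (in smooth_diffop) energy_free_solution_not_less:
  assumes hypo: "hypoelliptic A b" and w: "smooth_on UNIV w"
    and sol: "\<And>x. L w x = 0" and energy: "\<And>x. energy w x = 0"
  shows "\<not> w x < w y"
proof
  assume "w x < w y"
  then obtain c where c: "w x < c" "c < w y"
    using dense by blast
  define \<sigma> where "\<sigma> t = t * (1 / sqrt (1 + t\<^sup>2))" for t :: real
  define f where "f k z = \<sigma> (real k * (w z - c))" for k z
  define s where "s z = sgn (w z - c)" for z
  have w_cont: "continuous_on UNIV w"
    by (rule smooth_on_imp_continuous_on[OF w])
  have f_smooth: "smooth_on UNIV (f k)" for k
    unfolding f_def \<sigma>_def by (intro smooth_on_compose[OF smooth_algebraic_sigmoid] smooth_on_intros w)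
  have Lf: "L (f k) z = 0" for k z
  proof -
    define F where "F t = \<sigma> (real k * (t - c))" for t
    define F' where "F' t = real k * (1 / sqrt (1 + (real k * (t - c))\<^sup>2)) ^ 3" for t
    have "((\<lambda>t. real k * (t - c)) has_real_derivative real k) (at t)" for t
      by (auto intro!: derivative_eq_intros)
    from DERIV_chain2[OF DERIV_algebraic_sigmoid this]
    have F: "(F has_real_derivative F' t) (at t)" for t
      by (simp add: F_def[abs_def] F'_def \<sigma>_def mult.commute)
    have F'_smooth: "smooth_on UNIV F'"
      unfolding F'_def[abs_def]
      by (intro smooth_on_compose[OF smooth_inverse_sqrt_one_plus_sq] smooth_on_intros)
    \<comment> \<open>The second derivative multiplies the vanishing energy, so its existence
      suffices and no formula is computed.\<close>
    have "(F' has_real_derivative deriv F' t) (at t)" for t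
      using smooth_on_imp_has_derivative[OF F'_smooth, of t]
      by (simp add: DERIV_deriv_iff_real_differentiable differentiable_def) blast
    from L_compose[OF w F'_smooth F this, of z] show ?thesis
      by (simp add: f_def[abs_def] F_def sol energy)
  qed
  have \<sigma>_le: "\<bar>\<sigma> t\<bar> \<le> 1" for t
  proof -
    have "\<bar>t\<bar> \<le> sqrt (1 + t\<^sup>2)"
      by (rule real_le_rsqrt) simp
    then show ?thesis
      by (simp add: \<sigma>_def abs_mult add_nonneg_eq_0_iff divide_le_eq_1 add_pos_nonneg)
  qed
  have f_lim: "(\<lambda>k. f k z) \<longlonglongrightarrow> s z" for z
  proof (cases "w z = c")
    case True
    then show ?thesis by (simp add: f_def s_def \<sigma>_def)
  next
    case False
    define d where "d = w z - c"
    \<comment> \<open>\<open>f k z\<close> after cancelling \<open>real k\<close> from numerator and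
      denominator, which is possible once \<open>k > 0\<close>; the limit
      \<open>d / \<bar>d\<bar>\<close> is the sign of \<open>d\<close>.\<close>
    have lim: "(\<lambda>k. d / sqrt (inverse (real k) ^ 2 + d\<^sup>2)) \<longlonglongrightarrow> d / sqrt (0 ^ 2 + d\<^sup>2)"
      using False by (intro tendsto_intros lim_inverse_n) (simp add: d_def)
    have eq: "d / sqrt (0 ^ 2 + d\<^sup>2) = s z"
      using False by (simp add: d_def s_def sgn_div_norm divide_inverse mult.commute)
    have ev: "\<forall>\<^sub>F k in sequentially. d / sqrt (inverse (real k) ^ 2 + d\<^sup>2) = f k z"
      using eventually_gt_at_top[of 0]
    proof eventually_elim
      case (elim k)
      have "1 + (real k * d)\<^sup>2 = (real k)\<^sup>2 * (inverse (real k) ^ 2 + d\<^sup>2)"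
        using elim by (simp add: field_simps)
      then have "sqrt (1 + (real k * d)\<^sup>2) = real k * sqrt (inverse (real k) ^ 2 + d\<^sup>2)"
        by (simp add: real_sqrt_mult)
      then show ?case
        using elim by (simp add: f_def \<sigma>_def d_def)
    qed
    show ?thesis
      using Lim_transform_eventually[OF lim ev] by (simp only: eq)
  qed
  have s_le: "\<bar>s z\<bar> \<le> 1" for z
    by (simp add: s_def sgn_if)
  have s_meas: "s \<in> borel_measurable borel"
    using borel_measurable_continuous_onI[OF w_cont] unfolding s_def[abs_def] by measurable
  define T where "T \<phi> = (LINT z|lborel. s z * \<phi> z)" for \<phi>
  have "diffop_distr A b T \<phi> = 0" if "\<phi> \<in> test_functions UNIV" for \<phi>
  proof -
    define K where "K = support \<phi>"
    have \<phi>: "smooth_on UNIV \<phi>" and K: "compact K" "\<And>z. z \<notin> K \<Longrightarrow> \<phi> z = 0"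
      using that not_in_support by (auto simp: test_functions_def K_def)
    have cont: "continuous_on UNIV (L_adj \<phi>)"
      by (intro smooth_on_imp_continuous_on smooth_on_L_adj \<phi>)
    have int: "integrable lborel (L_adj \<phi>)"
      by (rule integrable_continuous_compact_support[OF cont K(1) L_adj_eq_0_outside[OF compact_imp_closed[OF K(1)] K(2)]])
    have "(\<lambda>k. LINT z|lborel. f k z * L_adj \<phi> z) \<longlonglongrightarrow> (LINT z|lborel. s z * L_adj \<phi> z)"
    proof (rule integral_dominated_convergence)
      show "integrable lborel (\<lambda>z. \<bar>L_adj \<phi> z\<bar>)" using int by simp
      show "AE z in lborel. (\<lambda>k. f k z * L_adj \<phi> z) \<longlonglongrightarrow> s z * L_adj \<phi> z"
        by (intro AE_I2 tendsto_mult f_lim tendsto_const)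
      show "AE z in lborel. norm (f k z * L_adj \<phi> z) \<le> \<bar>L_adj \<phi> z\<bar>" for k
        using \<sigma>_le by (simp add: abs_mult mult_left_le_one_le f_def)
      show "(\<lambda>z. s z * L_adj \<phi> z) \<in> borel_measurable lborel"
        using s_meas borel_measurable_continuous_onI[OF cont] by simp
      show "(\<lambda>z. f k z * L_adj \<phi> z) \<in> borel_measurable lborel" for k
        using borel_measurable_continuous_onI[OF smooth_on_imp_continuous_on[OF f_smooth[of k]]]
          borel_measurable_continuous_onI[OF cont] by simp
    qed
    moreover have "(LINT z|lborel. f k z * L_adj \<phi> z) = 0" for k
      using integral_by_parts[OF f_smooth \<phi> K] by (simp add: Lf)
    ultimately show ?thesis
      by (simp add: diffop_distr_def T_def LIMSEQ_const_iff)
  qed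
  then have "smooth_distribution_on UNIV (diffop_distr A b T)"
    unfolding smooth_distribution_on_def set_lebesgue_integral_def
    by (intro exI[of _ "\<lambda>z. 0"]) (simp add: smooth_on_const)
  moreover have "distribution_on UNIV T"
    unfolding T_def by (rule distribution_on_bounded_function[OF s_meas s_le])
  ultimately have "smooth_distribution_on UNIV T"
    using hypo unfolding hypoelliptic_def by blast
  then obtain g where g: "smooth_on UNIV g"
    and Tg: "\<And>\<phi>. \<phi> \<in> test_functions UNIV \<Longrightarrow> T \<phi> = (LINT z:UNIV|lebesgue. g z * \<phi> z)"
    unfolding smooth_distribution_on_def by blast
  have g_cont: "continuous_on UNIV g"
    by (rule smooth_on_imp_continuous_on[OF g])
  \<comment> \<open>\<open>g\<close> and \<open>s\<close> agree as distributions only, hence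
    pointwise on open sets where \<open>s\<close> is constant.\<close>
  have g_eq: "g z = a" if U: "open U" "z \<in> U" "\<And>y. y \<in> U \<Longrightarrow> s y = a" for U z a
  proof -
    have "g z - a = 0"
    proof (rule continuous_eq_0_if_orthogonal_to_test_functions[where d = "\<lambda>y. g y - a", OF _ U(1,2)])
      show "continuous_on UNIV (\<lambda>y. g y - a)"
        by (intro continuous_intros g_cont)
      fix \<phi> :: "real^'n \<Rightarrow> real"
      assume \<phi>: "\<phi> \<in> test_functions UNIV" and \<phi>0: "\<And>y. y \<notin> U \<Longrightarrow> \<phi> y = 0"
      have \<phi>_cont: "continuous_on UNIV \<phi>" and K: "compact (support \<phi>)"
        using \<phi> by (auto simp: test_functions_def smooth_on_imp_continuous_on)
      have int: "integrable lborel (\<lambda>y. h y * \<phi> y)" if "continuous_on UNIV h" for h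
        by (rule integrable_continuous_compact_support[OF continuous_on_mult[OF that \<phi>_cont] K])
          (simp add: not_in_support)
      have "T \<phi> = (LINT y|lborel. g y * \<phi> y)"
        using Tg[OF \<phi>] continuous_on_mult[OF g_cont \<phi>_cont]
        by (simp add: set_lebesgue_integral_def integral_completion borel_measurable_continuous_onI)
      moreover have "T \<phi> = (LINT y|lborel. a * \<phi> y)"
        unfolding T_def using U(3) \<phi>0 by (intro Bochner_Integration.integral_cong) (metis mult_zero_right)+
      ultimately show "(LINT y|lborel. (g y - a) * \<phi> y) = 0"
        using int[OF g_cont] int[OF continuous_on_const, of a] by (simp add: left_diff_distrib)
    qed
    then show ?thesis by simp
  qed
  \<comment> \<open>On the level set \<open>w z = c\<close>, which may have empty interior,
    \<open>g\<close> is not known directly. But the open set \<open>- D\<close> lies inside that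
    level set, where \<open>s\<close> is 0, so \<open>g\<close> is 0 on \<open>- D\<close>; this
    contradicts the choice of \<open>D\<close> unless \<open>- D\<close> is empty.\<close>
  define D where "D = {z. g z \<in> {-1, 0, 1}}"
  have above: "g z = 1" if "c < w z" for z
    by (rule g_eq[of "{z. c < w z}"]) (use that w_cont in \<open>auto simp: s_def intro!: open_Collect_less continuous_intros\<close>)
  have below: "g z = -1" if "w z < c" for z
    by (rule g_eq[of "{z. w z < c}"]) (use that w_cont in \<open>auto simp: s_def intro!: open_Collect_less continuous_intros\<close>)
  have "closed (g -` {-1, 0, 1})"
    using continuous_closed_vimage[of "{-1, 0, 1}" g] g_cont by (simp add: continuous_on_eq_continuous_at)
  then have "open (- D)"
    by (simp add: D_def vimage_def open_Compl)
  moreover have level: "w z = c" if "z \<in> - D" for z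
    using that above[of z] below[of z]
    by (cases "w z" c rule: linorder_cases) (auto simp: D_def)
  ultimately have "g z = 0" if "z \<in> - D" for z
    using that by (intro g_eq[of "- D"]) (auto simp: s_def level)
  then have "g z \<in> {-1, 0, 1}" for z
    by (cases "z \<in> D") (auto simp: D_def)
  then have "range g \<subseteq> {-1, 0, 1}" by blast
  then have "finite (range g)"
    by (rule finite_subset) simp
  \<comment> \<open>A continuous function with three possible values on a connected space is
    constant, yet \<open>g\<close> is 1 at \<open>y\<close> and -1 at \<open>x\<close>.\<close>
  then have "g constant_on UNIV"
    using continuous_finite_range_constant[OF connected_UNIV g_cont] by blast
  then show False
    using above[OF c(2)] below[OF c(1)] by (auto simp: constant_on_def)
qed

section \<open>From constancy to vanishing of the solution\<close>

theorem theorem1p1: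
  fixes A :: "real^'n \<Rightarrow> real^'n^'n"
    and b :: "real^'n \<Rightarrow> real^'n"
    and mul :: "real^'n \<Rightarrow> real^'n \<Rightarrow> real^'n"
    and p :: real
    and u :: "real^'n \<Rightarrow> real"
  assumes A_smooth: "\<And>i j. smooth_on UNIV (\<lambda>x. A x $ i $ j)"
    and b_smooth: "\<And>j. smooth_on UNIV (\<lambda>x. b x $ j)"
    and A_symmetric: "\<And>x. transpose (A x) = A x"
    and A_nonneg: "\<And>x \<xi>. (A x *v \<xi>) \<bullet> \<xi> \<ge> 0"
    and A_trace: "trace (A 0) > 0"
    and hypo: "hypoelliptic A b"
    and group: "lie_group mul"
    and left_inv: "left_translation_invariant mul (diffop A b)"
    and leb_left: "lebesgue_left_invariant mul"
    and leb_right: "lebesgue_right_invariant mul"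
    and p: "1 \<le> p"
    and u_Lp: "in_Lp p u"
    and u_smooth: "smooth_on UNIV u"
    and u_sol: "\<And>x. diffop A b u x = 0"
  shows "\<forall>x. u x = 0"
proof -
  obtain e inv where G: "Groups.group mul e inv" and mul_smooth: "smooth_on UNIV (\<lambda>(x, y). mul x y)"
    using group by (auto simp: lie_group_def)
  interpret G: Groups.group mul e inv by (rule G)
  interpret invariant_diffop A b mul e inv
    by unfold_locales (rule A_smooth b_smooth A_symmetric mul_smooth left_inv leb_left leb_right)+
  define w where "w x = u x ^ 3" for x
  have w: "smooth_on UNIV w"
    unfolding w_def[abs_def] by (rule smooth_on_power[OF u_smooth])
  have deriv: "((\<lambda>t. t ^ 3) has_real_derivative 3 * t\<^sup>2) (at t)"
    "((\<lambda>t. 3 * t\<^sup>2) has_real_derivative 6 * t) (at t)" for t :: real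
    by (auto intro!: derivative_eq_intros)
  text \<open>\<open>energy u\<close> is only known to vanish where \<open>u \<noteq> 0\<close>; cubing removes the exception.\<close>
  have vanish: "u x * energy u x = 0" for x
    using energy_eq_0_of_Lp_solution[OF A_nonneg p u_Lp u_smooth u_sol, of x] by auto
  \<comment> \<open>The chain rule gives \<open>6 * u x * energy u x\<close> here and
    \<open>9 * u x ^ 4 * energy u x\<close> for the energy of \<open>w\<close>; both contain the
    vanishing product.\<close>
  have "L w x = 0" for x
    unfolding w_def[abs_def]
    using L_compose[OF u_smooth _ deriv, of x] vanish[of x] by (simp add: smooth_on_intros u_sol)
  moreover have "energy w x = 0" for x
    unfolding w_def[abs_def] using energy_compose[OF u_smooth deriv(1), of x] vanish[of x] by auto
  ultimately have "\<not> w x < w y" for x y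
    using energy_free_solution_not_less[OF hypo w] by blast
  then have w_const: "w x = w 0" for x
    by (meson linorder_neqE)
  have "u x = root 3 (w x)" for x
    by (simp add: w_def odd_real_root_power_cancel)
  then have u_const: "u x = u 0" for x
    using w_const[of x] by metis
  have "integrable lebesgue (\<lambda>x::real^'n. \<bar>u 0\<bar> powr p)"
    using u_Lp by (subst (asm) in_Lp_def, subst (asm) u_const) simp
  \<comment> \<open>The whole space has infinite measure, so 0 is the only integrable
    constant.\<close>
  then have "\<bar>u 0\<bar> powr p = 0"
    by (simp add: integrable_iff_bounded ennreal_mult_less_top)
  then have "u 0 = 0" by simp
  then show ?thesis
    using u_const by metis
qed

end
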